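(* Assume $M_x\ge1$ and $0<\eta<\frac{2\varepsilon}{M_x^2}$. Let $(f^t,g^t,h^t)$ and $(\tilde f^{t+1},\tilde g^{t+1},\tilde h^{t+1})$, $t\in\mathbb{N}_0$, be generated by the modified Sinkhorn algorithm with step size $\eta$ started from $(f^0,g^0,h^0)\in\mathcal{C}_\diamond(\mathcal{U})\times\mathcal{C}_\diamond(\mathcal{U};\mathbb{R}^{d_x})\times\mathcal{C}(\mathcal{X}\times\mathcal{Y})$. Let $D_0:=D(f^0,g^0,h^0)$, let $\bar D$ be the maximal value of the dual objective $D$, let $\delta:=1/(2\|\Sigma_X^{-1}\|_{\mathrm{op}}M_x)$ and $$K_g^{\star\star}:=5\|c\|_\infty-\frac32D_0+\varepsilon\log\left(\frac32\right).$$ Then for every $t\in\mathbb{N}_0$, $$\|\tilde g^{t+1}\|_\infty\vee\|g^{t+1}\|_\infty\le\eta M_x+\left[\|g^0\|_\infty\vee\left(\frac{2K_g^{\star\star}+6\eta(1\vee\delta)M_x^2}{\delta}\right)\right]+\frac{2e^{1/2}}{\delta}\left(1-\frac{\eta M_x^2}{2\varepsilon}\right)^{-1}\left(1+\frac{2M_x}{\delta}\right)(\bar D-D_0)=:K_g^\star,$$ $$\|\tilde f^{t+1}\|_\infty\vee\|f^{t+1}\|_\infty\le L_c\,\mathrm{diam}(\mathcal{U})+2K_g^\star M_x+\|c\|_\infty-D_0=:K_f^\star,$$ $$\|\tilde h^{t+1}\|_\infty\vee\|h^{t+1}\|_\infty\le\|c\|_\infty+2K_f^\star+2K_g^\star M_x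 .$$
   Context: Setting. Let $(X,Y)$ be a random vector in $\mathbb{R}^{d_x}\times\mathbb{R}^{d_y}$ with law $\nu$; let $\mathcal{X}$, $\mathcal{Y}$ be the supports of $X$, $Y$. Let $\mu$ be a Borel probability measure on $\mathbb{R}^{d_y}$ with support $\mathcal{U}$. Assume $\mathcal{U},\mathcal{X},\mathcal{Y}$ are compact, $\mathbb{E}[X]=0$ and $\Sigma_X:=\mathbb{E}[XX^\top]$ is invertible. Fix $\varepsilon>0$; $c(u,y):=\|u-y\|^2/2$. The dual objective is $$D(f,g,h):=\int f\,d\mu+\int h\,d\nu-\varepsilon\left(\int e^{(f(u)+\langle g(u),x\rangle+h(x,y)-c(u,y))/\varepsilon}\,d(\mu\otimes\nu)(u,x,y)-1\right).$$ Its supremum over $L^1(\mu)\times L^1(\mu;\mathbb{R}^{d_x})\times L^1(\nu)$ is known to be attained; $\bar D$ denotes this maximal value. Notation. $M_x:=\sup_{x\in\mathcal{X}}\|x\|$; $\|c\|_\infty:=\sup_{\mathcal{U}\times\mathcal{Y}}c$; $L_c:=\sup_{u\in\mathcal{U}}\|u\|+\sup_{y\in\mathcal{Y}}\|y\|$; $a\vee b=\max\{a,b\}$. $\mathcal{C}_\diamond(\mathcal{U})$ (resp. $\mathcal{C}_\diamond(\mathcal{U};\mathbb{R}^{d_x})$) is the set of continuous $f:\mathcal{U}\to\mathbb{R}$ (resp. $g:\mathcal{U}\to\mathbb{R}^{d_x}$) with $\int f\,d\mu=0$ (resp. $\int g\,d\mu=0$). $\|\cdot\|_\infty$ is the sup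 norm over the domain ($\mathcal{U}$ or $\mathcal{X}\times\mathcal{Y}$), using the Euclidean norm for vector values. Modified Sinkhorn algorithm with step size $\eta>0$. Given $(f^t,g^t,h^t)$: (1) $\tilde h^{t+1}(x,y)=-\varepsilon\log\int e^{(f^t(u)+\langle g^t(u),x\rangle-c(u,y))/\varepsilon}d\mu(u)$ and then $\tilde f^{t+1}(u)=-\varepsilon\log\int e^{(\langle g^t(u),x\rangle+\tilde h^{t+1}(x,y)-c(u,y))/\varepsilon}d\nu(x,y)$; (2) $\tilde g^{t+1}=g^t-\eta\,d_g^t$ with $d_g^t(u)=e^{\tilde f^{t+1}(u)/\varepsilon}\int x\,e^{(\langle g^t(u),x\rangle+\tilde h^{t+1}(x,y)-c(u,y))/\varepsilon}d\nu(x,y)$; (3) $f^{t+1}=\tilde f^{t+1}-\int\tilde f^{t+1}d\mu$, $g^{t+1}=\tilde g^{t+1}-\int\tilde g^{t+1}d\mu$, $h^{t+1}(x,y)=\tilde h^{t+1}(x,y)+\int\tilde f^{t+1}d\mu+\langle\int\tilde g^{t+1}d\mu,x\rangle$. *)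

theory Defs
  imports "HOL-Probability.Probability"
begin

definition msupport :: "'a::topological_space measure \<Rightarrow> 'a set" where
  "msupport M = {x. \<forall>W. open W \<and> x \<in> W \<longrightarrow> emeasure M W > 0}"

definition cost :: "'b::real_normed_vector \<Rightarrow> 'b \<Rightarrow> real" where
  "cost u y = (norm (u - y))\<^sup>2 / 2"

text \<open>
  A function on a set \<open>S\<close> is represented by a total function whose values outside \<open>S\<close> are irrelevant.
  Therefore every integral below is restricted to \<open>U\<close> (to be the support of \<open>\<mu>\<close>) or to \<open>S\<close>
  (to be the product of the supports of the marginals of \<open>\<nu>\<close>); these sets have full measure,
  but outside them the representing functions need not even be measurable.

  The supremum norm takes values in the extended reals, so that an upper bound on it is meaningful
  without a separate boundedness claim.
\<close>

definition sup_norm :: "'a set \<Rightarrow> ('a \<Rightarrow> 'b::real_normed_vector) \<Rightarrow> ereal" where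
  "sup_norm S f = (SUP z\<in>S. ereal (norm (f z)))"

definition C_diamond ::
  "'b::topological_space set \<Rightarrow> 'b measure \<Rightarrow> ('b \<Rightarrow> 'c::{banach, second_countable_topology}) set" where
  "C_diamond U \<mu> = {f. continuous_on U f \<and> (LINT u:U|\<mu>. f u) = 0}"

text \<open>
  The exponential integral may be infinite for integrable \<open>f\<close>, \<open>g\<close>, \<open>h\<close>; the objective is then
  \<open>-\<infinity>\<close>, whence the nonnegative Lebesgue integral and the extended reals.
\<close>

definition dual_objective ::
  "'b::euclidean_space set \<Rightarrow> ('a::euclidean_space \<times> 'b) set \<Rightarrow> 'b measure \<Rightarrow> ('a \<times> 'b) measure \<Rightarrow> real
    \<Rightarrow> ('b \<Rightarrow> real) \<Rightarrow> ('b \<Rightarrow> 'a) \<Rightarrow> ('a \<times> 'b \<Rightarrow> real) \<Rightarrow> ereal" where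
  "dual_objective U S \<mu> \<nu> \<epsilon> f g h =
     ereal (LINT u:U|\<mu>. f u) + ereal (LINT z:S|\<nu>. h z)
     - ereal \<epsilon> * (enn2ereal (\<integral>\<^sup>+w\<in>U \<times> S. (case w of (u, (x, y)) \<Rightarrow>
           ennreal (exp ((f u + g u \<bullet> x + h (x, y) - cost u y) / \<epsilon>))) \<partial>(\<mu> \<Otimes>\<^sub>M \<nu>)) - 1)"

definition dual_value ::
  "'b::euclidean_space set \<Rightarrow> ('a::euclidean_space \<times> 'b) set \<Rightarrow> 'b measure \<Rightarrow> ('a \<times> 'b) measure \<Rightarrow> real
    \<Rightarrow> ereal" where
  "dual_value U S \<mu> \<nu> \<epsilon> =
     (SUP (f, g, h) \<in> {f. set_integrable \<mu> U f} \<times> {g. set_integrable \<mu> U g} \<times> {h. set_integrable \<nu> S h}.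
        dual_objective U S \<mu> \<nu> \<epsilon> f g h)"

text \<open>
  The functions \<open>ft\<close>, \<open>gt\<close>, \<open>ht\<close> are the iterates with a tilde; they are only meaningful at
  indices \<open>Suc t\<close>.
\<close>

definition modified_sinkhorn ::
  "'b::euclidean_space set \<Rightarrow> ('a::euclidean_space \<times> 'b) set \<Rightarrow> 'b measure \<Rightarrow> ('a \<times> 'b) measure
    \<Rightarrow> real \<Rightarrow> real
    \<Rightarrow> (nat \<Rightarrow> 'b \<Rightarrow> real) \<Rightarrow> (nat \<Rightarrow> 'b \<Rightarrow> 'a) \<Rightarrow> (nat \<Rightarrow> 'a \<times> 'b \<Rightarrow> real)
    \<Rightarrow> (nat \<Rightarrow> 'b \<Rightarrow> real) \<Rightarrow> (nat \<Rightarrow> 'b \<Rightarrow> 'a) \<Rightarrow> (nat \<Rightarrow> 'a \<times> 'b \<Rightarrow> real) \<Rightarrow> bool" where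
  "modified_sinkhorn U S \<mu> \<nu> \<epsilon> \<eta> f g h ft gt ht \<longleftrightarrow>
    (\<forall>t.
      (\<forall>(x, y)\<in>S. ht (Suc t) (x, y) =
         - \<epsilon> * ln (LINT u:U|\<mu>. exp ((f t u + g t u \<bullet> x - cost u y) / \<epsilon>))) \<and>
      (\<forall>u\<in>U. ft (Suc t) u =
         - \<epsilon> * ln (LINT z:S|\<nu>. exp ((g t u \<bullet> fst z + ht (Suc t) z - cost u (snd z)) / \<epsilon>))) \<and>
      (\<forall>u\<in>U. gt (Suc t) u = g t u - \<eta> *\<^sub>R (exp (ft (Suc t) u / \<epsilon>) *\<^sub>R
         (LINT z:S|\<nu>. exp ((g t u \<bullet> fst z + ht (Suc t) z - cost u (snd z)) / \<epsilon>) *\<^sub>R fst z))) \<and>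
      (\<forall>u\<in>U. f (Suc t) u = ft (Suc t) u - (LINT v:U|\<mu>. ft (Suc t) v)) \<and>
      (\<forall>u\<in>U. g (Suc t) u = gt (Suc t) u - (LINT v:U|\<mu>. gt (Suc t) v)) \<and>
      (\<forall>(x, y)\<in>S. h (Suc t) (x, y) =
         ht (Suc t) (x, y) + (LINT v:U|\<mu>. ft (Suc t) v) + (LINT v:U|\<mu>. gt (Suc t) v) \<bullet> x))"

end

theory Submission
  imports Defs
begin

text \<open>
  The exact updates of \<open>h\<close> and \<open>f\<close> increase the dual objective, and the gradient step in \<open>g\<close>
  increases it by at least \<open>\<eta> (1 - \<eta> M\<^sub>x\<^sup>2 / (2 \<epsilon>))\<close> times the squared \<open>L\<^sup>2\<close> norm of the
  gradient \<open>d\<close>, while the objective never exceeds the maximum of the cost. Hence the squared \<open>L\<^sup>2\<close>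
  norms of the gradients are summable. Pointwise, \<open>d(u) \<bullet> g(u) \<ge> \<delta> |g(u)| - K\<close>, so a gradient step
  shrinks \<open>g(u)\<close> when it is large. The subsequent recentring adds \<open>\<eta>\<close> times the mean of \<open>d\<close>; this
  is absorbed by the shrinking if the mean is below \<open>\<delta> / 2\<close>, and the remaining recentrings have a
  bounded sum because the squares are summable. The bounds on \<open>f\<close> and \<open>h\<close> follow from those on \<open>g\<close>:
  the log-integral formulas bound their oscillation, and the ascent of the dual bounds their means.
\<close>

subsection \<open>Real inequalities\<close>

text \<open>The ascent controls the gradients only in \<open>L\<^sup>2\<close>, whereas sup norms
  are wanted and recentring couples all points \<open>u\<close>. But the coupling passes only
  through the mean of \<open>d\<close>, which an \<open>L\<^sup>2\<close> norm controls; the rest is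
  decided pointwise in \<open>u\<close>. This works because, after the exact
  \<open>f\<close>-update, the Gibbs density at each \<open>u\<close> is a probability density in
  \<open>(x, y)\<close>. So \<open>d(u)\<close> is a mean of \<open>x\<close>, its norm is at most
  \<open>M\<^sub>x\<close>, and both the gain of a gradient step and coercivity concern a single
  tilted probability measure.

  The slope \<open>\<delta>\<close> comes from the vector
  \<open>w = \<delta> inv(\<Sigma>) v / |v|\<close>: its norm is at most
  \<open>1 / (2 M\<^sub>x)\<close>, so \<open>1 + w \<bullet> x\<close> is a density, and the
  covariance of \<open>w \<bullet> x\<close> with \<open>v \<bullet> x\<close> is
  \<open>\<delta> |v|\<close>. A mean of norm below \<open>\<delta> / 2\<close> uses up only half of
  this slope.

  Recentring is what yields the upper bound on the tilded \<open>h\<close>, and it preserves the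
  dual because \<open>X\<close> has mean zero. Most one-sided bounds below are
  \<open>exp s \<ge> 1 + s\<close>, integrated against a suitable measure.\<close>

lemma sinh_le_mult_cosh:
  fixes b :: real
  assumes "0 \<le> b"
  shows "sinh b \<le> b * cosh b"
proof -
  have "(\<lambda>b. b * cosh b - sinh b) 0 \<le> (\<lambda>b. b * cosh b - sinh b) b"
    using assms
  proof (rule DERIV_nonneg_imp_nondecreasing)
    fix y :: real
    assume y: "0 \<le> y" "y \<le> b"
    have "((\<lambda>b. b * cosh b - sinh b) has_real_derivative y * sinh y) (at y)"
      by (auto intro!: derivative_eq_intros)
    then show "\<exists>D. ((\<lambda>b. b * cosh b - sinh b) has_real_derivative D) (at y) \<and> 0 \<le> D"
      using y by (intro exI[of _ "y * sinh y"]) auto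
  qed
  then show ?thesis by simp
qed

text \<open>For positive \<open>b\<close> this is \<open>tanh (b/2) \<le> b/2\<close>;
  differentiating once reduces it to \<open>sinh_le_mult_cosh\<close>.\<close>

lemma cosh_minus_one_le:
  fixes b :: real
  assumes "0 \<le> b"
  shows "cosh b - 1 \<le> b / 2 * sinh b"
proof -
  have "(\<lambda>b. b / 2 * sinh b - cosh b + 1) 0 \<le> (\<lambda>b. b / 2 * sinh b - cosh b + 1) b"
    using assms
  proof (rule DERIV_nonneg_imp_nondecreasing)
    fix y :: real
    assume y: "0 \<le> y" "y \<le> b"
    have "((\<lambda>b. b / 2 * sinh b - cosh b + 1) has_real_derivative (y * cosh y - sinh y) / 2) (at y)"
      by (auto intro!: derivative_eq_intros simp: field_simps)
    then show "\<exists>D. ((\<lambda>b. b / 2 * sinh b - cosh b + 1) has_real_derivative D) (at y) \<and> 0 \<le> D"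
      using sinh_le_mult_cosh[of y] y by (intro exI[of _ "(y * cosh y - sinh y) / 2"]) auto
  qed
  then show ?thesis by simp
qed

lemma le_sinh:
  fixes b :: real
  assumes "0 \<le> b"
  shows "b \<le> sinh b"
proof -
  have "(\<lambda>b. sinh b - b) 0 \<le> (\<lambda>b. sinh b - b) b"
    using assms
  proof (rule DERIV_nonneg_imp_nondecreasing)
    fix y :: real
    have "((\<lambda>b. sinh b - b) has_real_derivative cosh y - 1) (at y)"
      by (auto intro!: derivative_eq_intros)
    then show "\<exists>D. ((\<lambda>b. sinh b - b) has_real_derivative D) (at y) \<and> 0 \<le> D"
      using cosh_real_ge_1[of y] by (intro exI[of _ "cosh y - 1"]) auto
  qed
  then show ?thesis by simp
qed

text \<open>The right side is the chord of the convex function \<open>exp\<close> over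
  \<open>[- b, b]\<close>, read at the point \<open>- z\<close>.\<close>

lemma exp_minus_le_chord:
  fixes b z :: real
  assumes "\<bar>z\<bar> \<le> b" "0 < b"
  shows "exp (- z) \<le> cosh b - z / b * sinh b"
proof -
  let ?l = "(b - z) / (2 * b)"
  have l: "0 \<le> ?l" "?l \<le> 1"
    using assms by (auto simp: field_simps abs_le_iff)
  have eq: "(1 - ?l) *\<^sub>R (- b) + ?l *\<^sub>R b = - z"
    using assms by (simp add: field_simps)
  have "convex_on UNIV (exp :: real \<Rightarrow> real)"
    using exp_convex by blast
  from convex_onD[OF this l, of "- b" b]
  have "exp (- z) \<le> (1 - ?l) * exp (- b) + ?l * exp b"
    unfolding eq by simp
  also have "\<dots> = cosh b - z / b * sinh b"
    using assms by (simp add: cosh_field_def sinh_field_def field_simps exp_minus)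
  finally show ?thesis .
qed

text \<open>One step of the centred gradient iteration at a fixed point: \<open>v\<close> is the current vector, \<open>d\<close> its
  gradient and \<open>m\<close> the mean of the gradients. Coercivity of the gradient makes the norm decrease far
  from the origin, unless the recentring by \<open>m\<close> is large.\<close>

lemma drift_step_bound:
  fixes v d m :: "'a::real_inner"
  assumes "norm d \<le> M" "norm m \<le> M" "1 \<le> M" "0 < \<eta>" "0 < \<delta>" "0 \<le> K" "0 \<le> S"
    and drift: "\<delta> * norm v - K \<le> d \<bullet> v"
    and R: "(2 * K + 6 * \<eta> * max 1 \<delta> * M\<^sup>2) / \<delta> \<le> R"
    and v: "norm v \<le> R + S"
  shows "norm (v - \<eta> *\<^sub>R d + \<eta> *\<^sub>R m) \<le> R + S + (if \<delta> / 2 \<le> norm m then \<eta> * norm m else 0)"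
proof -
  have MM: "M \<le> M\<^sup>2" using \<open>1 \<le> M\<close> by (simp add: power2_eq_square)
  \<comment> \<open>Beyond this threshold, \<open>norm m < \<delta> / 2\<close> forces
    \<open>2 * ((m - d) \<bullet> v) \<le> - 4 * \<eta> * M\<^sup>2\<close>. Multiplied by
    \<open>\<eta>\<close>, this pays for the squared length of the step, because
    \<open>norm (m - d) \<le> 2 * M\<close>.\<close>
  consider (small) "\<delta> * norm v \<le> 2 * K + 4 * \<eta> * M\<^sup>2"
    | (shrink) "2 * K + 4 * \<eta> * M\<^sup>2 < \<delta> * norm v" "norm m < \<delta> / 2"
    | (large) "2 * K + 4 * \<eta> * M\<^sup>2 < \<delta> * norm v" "\<delta> / 2 \<le> norm m"
    by linarith
  then show ?thesis
  proof cases
    case small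
    have "norm (v - \<eta> *\<^sub>R d + \<eta> *\<^sub>R m) \<le> norm v + norm (\<eta> *\<^sub>R d) + norm (\<eta> *\<^sub>R m)"
      by (meson norm_triangle_ineq norm_triangle_ineq4 add_right_mono order_trans)
    also have "\<dots> \<le> norm v + \<eta> * M + \<eta> * M"
      proof -
      have "norm (\<eta> *\<^sub>R d) \<le> \<eta> * M" "norm (\<eta> *\<^sub>R m) \<le> \<eta> * M"
        using assms by auto
      then show ?thesis by linarith
    qed
    finally have 1: "norm (v - \<eta> *\<^sub>R d + \<eta> *\<^sub>R m) \<le> norm v + 2 * (\<eta> * M)" by linarith
    \<comment> \<open>Two moves of length at most \<open>\<eta> * M\<close>, scaled by
      \<open>\<delta>\<close>, are added to the \<open>4 * \<eta> * M\<^sup>2\<close> of the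
      threshold. This is the origin of the factors \<open>6\<close> and
      \<open>max 1 \<delta>\<close> in the lower bound for \<open>R\<close>.\<close>
    have "\<delta> * (\<eta> * M) \<le> max 1 \<delta> * (\<eta> * M\<^sup>2)"
      using assms MM by (intro mult_mono) auto
    moreover have "\<eta> * M\<^sup>2 \<le> max 1 \<delta> * (\<eta> * M\<^sup>2)"
      using \<open>0 < \<eta>\<close> mult_right_mono[of 1 "max 1 \<delta>" "\<eta> * M\<^sup>2"] by simp
    ultimately have "\<delta> * (norm v + 2 * (\<eta> * M)) \<le> 2 * K + 6 * \<eta> * max 1 \<delta> * M\<^sup>2"
      using small by (simp add: algebra_simps)
    then have "norm v + 2 * (\<eta> * M) \<le> R"
      using R \<open>0 < \<delta>\<close> 
      by (intro order_trans[OF _ R]) (simp add: pos_le_divide_eq mult.commute)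
    with 1 show ?thesis
      using \<open>0 \<le> S\<close> \<open>0 < \<eta>\<close> by (auto intro: add_increasing2)
  next
    case shrink
    let ?w = "m - d"
    have w: "norm ?w \<le> 2 * M"
      using norm_triangle_ineq4[of m d] assms by linarith
    have "m \<bullet> v \<le> \<delta> / 2 * norm v"
      using norm_cauchy_schwarz[of m v] shrink mult_right_mono[of "norm m" "\<delta>/2" "norm v"] by simp
    then have "?w \<bullet> v \<le> K - \<delta> / 2 * norm v"
      using drift by (simp add: inner_diff_left)
    then have "2 * (?w \<bullet> v) \<le> - 4 * \<eta> * M\<^sup>2"
      using shrink by simp
    then have "2 * (\<eta> * (?w \<bullet> v)) \<le> - (4 * (\<eta>\<^sup>2 * M\<^sup>2))"
      using mult_left_mono[of "2 * (?w \<bullet> v)" "- 4 * \<eta> * M\<^sup>2" \<eta>] \<open>0 < \<eta>\<close>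
      by (simp add: power2_eq_square ac_simps)
    moreover have "\<eta>\<^sup>2 * (norm ?w)\<^sup>2 \<le> 4 * (\<eta>\<^sup>2 * M\<^sup>2)"
      using mult_left_mono[OF power_mono[OF w norm_ge_zero, of 2], of "\<eta>\<^sup>2"]
      by (simp add: power_mult_distrib)
    moreover have "(norm (v + \<eta> *\<^sub>R ?w))\<^sup>2 = (norm v)\<^sup>2 + 2 * (\<eta> * (?w \<bullet> v)) + \<eta>\<^sup>2 * (norm ?w)\<^sup>2"
      unfolding power2_norm_eq_inner
      by (simp add: inner_add_left inner_add_right inner_commute[of v "m - d"] power2_eq_square distrib_left)
    ultimately have "(norm (v + \<eta> *\<^sub>R ?w))\<^sup>2 \<le> (norm v)\<^sup>2"
      by linarith
    then have "norm (v + \<eta> *\<^sub>R ?w) \<le> norm v"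
      using power2_le_imp_le norm_ge_zero by blast
    then show ?thesis
      using v shrink by (simp add: algebra_simps)
  next
    case large
    \<comment> \<open>The direction of \<open>m\<close> is uncontrolled here. Only the gradient step
      is shown not to lengthen \<open>v\<close>; the recentring is then paid for in full by the
      triangle inequality.\<close>
    have "0 \<le> \<eta> * M\<^sup>2"
      using \<open>0 < \<eta>\<close> by simp
    then have "\<eta> * M\<^sup>2 \<le> 2 * (d \<bullet> v)"
      using drift large \<open>0 \<le> K\<close> by linarith
    then have "\<eta> * (\<eta> * M\<^sup>2) \<le> \<eta> * (2 * (d \<bullet> v))"
      using \<open>0 < \<eta>\<close> by (intro mult_left_mono) auto
    moreover have "\<eta>\<^sup>2 * (norm d)\<^sup>2 \<le> \<eta>\<^sup>2 * M\<^sup>2"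
      using assms by (intro mult_left_mono power_mono) auto
    moreover have "(norm (v - \<eta> *\<^sub>R d))\<^sup>2 = (norm v)\<^sup>2 - \<eta> * (2 * (d \<bullet> v)) + \<eta>\<^sup>2 * (norm d)\<^sup>2"
      unfolding power2_norm_eq_inner
      by (simp add: inner_diff_left inner_diff_right inner_commute[of v d] power2_eq_square right_diff_distrib)
    ultimately have "(norm (v - \<eta> *\<^sub>R d))\<^sup>2 \<le> (norm v)\<^sup>2"
      by (simp add: power2_eq_square)
    then have "norm (v - \<eta> *\<^sub>R d) \<le> norm v"
      using power2_le_imp_le norm_ge_zero by blast
    then show ?thesis
      using v large norm_triangle_ineq[of "v - \<eta> *\<^sub>R d" "\<eta> *\<^sub>R m"] \<open>0 < \<eta>\<close> by simp
  qed
qed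

subsection \<open>Bounded measurable functions\<close>

named_theorems bdd_intros

text \<open>This class is closed under all operations of the iteration and is integrable over any
  finite measure, so it settles every integrability side condition. The bound holds everywhere
  rather than almost everywhere, so it passes to sections of functions on a product.\<close>

definition bdd_measurable :: "'a measure \<Rightarrow> ('a \<Rightarrow> 'b::euclidean_space) \<Rightarrow> bool" where
  "bdd_measurable M f \<longleftrightarrow> f \<in> borel_measurable M \<and> (\<exists>B. \<forall>x\<in>space M. norm (f x) \<le> B)"

lemma bdd_measurableI:
  assumes "f \<in> borel_measurable M" "\<And>x. x \<in> space M \<Longrightarrow> norm (f x) \<le> B"
  shows "bdd_measurable M f"
  using assms unfolding bdd_measurable_def by blast

lemma bdd_measurableE:
  assumes "bdd_measurable M f"
  obtains B where "0 < B" "\<And>x. x \<in> space M \<Longrightarrow> norm (f x) \<le> B"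
proof -
  obtain B where "\<And>x. x \<in> space M \<Longrightarrow> norm (f x) \<le> B"
    using assms unfolding bdd_measurable_def by blast
  then show ?thesis
    by (intro that[of "max 1 B"]) (auto simp: le_max_iff_disj)
qed

lemma bdd_measurable_cong:
  "(\<And>x. x \<in> space M \<Longrightarrow> f x = g x) \<Longrightarrow> bdd_measurable M f \<longleftrightarrow> bdd_measurable M g"
  unfolding bdd_measurable_def using measurable_cong[of M f g] by auto

lemma bdd_measurable_borel_measurable [measurable_dest]:
  "bdd_measurable M f \<Longrightarrow> f \<in> borel_measurable M"
  unfolding bdd_measurable_def by blast

lemma bdd_measurable_const [bdd_intros]: "bdd_measurable M (\<lambda>_. a)"
  by (rule bdd_measurableI[where B = "norm a"]) auto

lemma bdd_measurable_add [bdd_intros]: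
  assumes "bdd_measurable M f" "bdd_measurable M g"
  shows "bdd_measurable M (\<lambda>x. f x + g x)"
proof -
  obtain A where A: "0 < A" "\<And>x. x \<in> space M \<Longrightarrow> norm (f x) \<le> A"
    using assms(1) by (rule bdd_measurableE) blast
  obtain B where B: "0 < B" "\<And>x. x \<in> space M \<Longrightarrow> norm (g x) \<le> B"
    using assms(2) by (rule bdd_measurableE) blast
  have [measurable]: "f \<in> borel_measurable M" "g \<in> borel_measurable M"
    using assms by (simp_all add: bdd_measurable_def)
  show ?thesis
  proof (rule bdd_measurableI)
    show "norm (f x + g x) \<le> A + B" if "x \<in> space M" for x
      using A(2)[OF that] B(2)[OF that] by (rule norm_triangle_mono)
  qed measurable
qed

lemma bdd_measurable_scaleR [bdd_intros]:
  assumes "bdd_measurable M f" "bdd_measurable M g"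
  shows "bdd_measurable M (\<lambda>x. f x *\<^sub>R g x)"
proof -
  obtain A where A: "0 < A" "\<And>x. x \<in> space M \<Longrightarrow> norm (f x) \<le> A"
    using assms(1) by (rule bdd_measurableE) blast
  obtain B where B: "0 < B" "\<And>x. x \<in> space M \<Longrightarrow> norm (g x) \<le> B"
    using assms(2) by (rule bdd_measurableE) blast
  have [measurable]: "f \<in> borel_measurable M" "g \<in> borel_measurable M"
    using assms by (simp_all add: bdd_measurable_def)
  show ?thesis
  proof (rule bdd_measurableI)
    show "norm (f x *\<^sub>R g x) \<le> A * B" if "x \<in> space M" for x
      using mult_mono[OF A(2)[OF that] B(2)[OF that]] A(1) by simp
  qed measurable
qed

lemma bdd_measurable_mult [bdd_intros]:
  fixes f g :: "'a \<Rightarrow> real"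
  assumes "bdd_measurable M f" "bdd_measurable M g"
  shows "bdd_measurable M (\<lambda>x. f x * g x)"
  using bdd_measurable_scaleR[OF assms] by simp

lemma bdd_measurable_inner [bdd_intros]:
  assumes "bdd_measurable M f" "bdd_measurable M g"
  shows "bdd_measurable M (\<lambda>x. f x \<bullet> g x)"
proof -
  obtain A where A: "0 < A" "\<And>x. x \<in> space M \<Longrightarrow> norm (f x) \<le> A"
    using assms(1) by (rule bdd_measurableE) blast
  obtain B where B: "0 < B" "\<And>x. x \<in> space M \<Longrightarrow> norm (g x) \<le> B"
    using assms(2) by (rule bdd_measurableE) blast
  have [measurable]: "f \<in> borel_measurable M" "g \<in> borel_measurable M"
    using assms by (simp_all add: bdd_measurable_def)
  show ?thesis
  proof (rule bdd_measurableI)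
    show "norm (f x \<bullet> g x) \<le> A * B" if "x \<in> space M" for x
      using mult_mono[OF A(2)[OF that] B(2)[OF that]] A(1) Cauchy_Schwarz_ineq2[of "f x" "g x"] by simp
  qed measurable
qed

lemma bdd_measurable_minus [bdd_intros]:
  assumes "bdd_measurable M f"
  shows "bdd_measurable M (\<lambda>x. - f x)"
  using bdd_measurable_scaleR[OF bdd_measurable_const[of M "-1"] assms] by simp

lemma bdd_measurable_diff [bdd_intros]:
  assumes "bdd_measurable M f" "bdd_measurable M g"
  shows "bdd_measurable M (\<lambda>x. f x - g x)"
  using bdd_measurable_add[OF assms(1) bdd_measurable_minus[OF assms(2)]] by simp

lemma bdd_measurable_divide [bdd_intros]:
  fixes f :: "'a \<Rightarrow> real"
  assumes "bdd_measurable M f"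
  shows "bdd_measurable M (\<lambda>x. f x / c)"
  using bdd_measurable_mult[OF assms bdd_measurable_const[of M "inverse c"]] by (simp add: field_simps)

lemma bdd_measurable_exp [bdd_intros]:
  fixes f :: "'a \<Rightarrow> real"
  assumes "bdd_measurable M f"
  shows "bdd_measurable M (\<lambda>x. exp (f x))"
proof -
  obtain A where A: "0 < A" "\<And>x. x \<in> space M \<Longrightarrow> norm (f x) \<le> A"
    using assms by (rule bdd_measurableE) blast
  have [measurable]: "f \<in> borel_measurable M"
    using assms by (simp add: bdd_measurable_def)
  show ?thesis
  proof (rule bdd_measurableI)
    show "norm (exp (f x)) \<le> exp A" if "x \<in> space M" for x
      using A(2)[OF that] by (simp add: abs_le_iff)
  qed measurable
qed

lemma bdd_measurable_norm [bdd_intros]: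
  assumes "bdd_measurable M f"
  shows "bdd_measurable M (\<lambda>x. norm (f x))"
proof -
  obtain A where A: "0 < A" "\<And>x. x \<in> space M \<Longrightarrow> norm (f x) \<le> A"
    using assms by (rule bdd_measurableE) blast
  have [measurable]: "f \<in> borel_measurable M"
    using assms by (simp add: bdd_measurable_def)
  show ?thesis
  proof (rule bdd_measurableI)
    show "norm (norm (f x)) \<le> A" if "x \<in> space M" for x
      using A(2)[OF that] by simp
  qed measurable
qed

lemma bdd_measurable_compose:
  assumes "bdd_measurable N f" "\<phi> \<in> measurable M N"
  shows "bdd_measurable M (\<lambda>x. f (\<phi> x))"
proof -
  obtain A where A: "0 < A" "\<And>x. x \<in> space N \<Longrightarrow> norm (f x) \<le> A"
    using assms(1) by (rule bdd_measurableE) blast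
  show ?thesis
  proof (rule bdd_measurableI)
    show "(\<lambda>x. f (\<phi> x)) \<in> borel_measurable M"
      using assms by (auto simp: bdd_measurable_def intro: measurable_compose)
    show "norm (f (\<phi> x)) \<le> A" if "x \<in> space M" for x
      using A(2) measurable_space[OF assms(2) that] by blast
  qed
qed

lemma (in finite_measure) bdd_measurable_integrable:
  assumes "bdd_measurable M f"
  shows "integrable M f"
proof -
  obtain A where "\<And>x. x \<in> space M \<Longrightarrow> norm (f x) \<le> A"
    by (meson assms bdd_measurableE)
  then show ?thesis
    using assms by (intro integrable_const_bound[where B = A]) auto
qed

section \<open>Means and exponential tilts on a probability space\<close>

lemma (in prob_space) norm_integral_le:
  fixes f :: "'a \<Rightarrow> 'b::euclidean_space"
  assumes "f \<in> borel_measurable M" "\<And>x. x \<in> space M \<Longrightarrow> norm (f x) \<le> B"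
  shows "norm (\<integral>x. f x \<partial>M) \<le> B"
proof -
  have "bdd_measurable M f"
    using assms by (rule bdd_measurableI)
  have "norm (\<integral>x. f x \<partial>M) \<le> (\<integral>x. norm (f x) \<partial>M)"
    by (rule integral_norm_bound)
  also have "\<dots> \<le> B"
    using assms \<open>bdd_measurable M f\<close>
    by (intro integral_le_const AE_I2 bdd_measurable_integrable bdd_intros)
  finally show ?thesis .
qed

text \<open>The difference of the two sides is the variance of \<open>f\<close>.\<close>

lemma (in prob_space) norm_integral_power2_le:
  fixes f :: "'a \<Rightarrow> 'b::euclidean_space"
  assumes "bdd_measurable M f"
  shows "(norm (\<integral>x. f x \<partial>M))\<^sup>2 \<le> (\<integral>x. (norm (f x))\<^sup>2 \<partial>M)"
proof -
  define m where "m = (\<integral>x. f x \<partial>M)"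
  have "0 \<le> (\<integral>x. (norm (f x - m))\<^sup>2 \<partial>M)"
    by simp
  also have "\<dots> = (\<integral>x. (norm (f x))\<^sup>2 - 2 * (f x \<bullet> m) + m \<bullet> m \<partial>M)"
    by (intro Bochner_Integration.integral_cong)
      (auto simp: power2_norm_eq_inner inner_diff_left inner_diff_right inner_commute)
  also have "\<dots> = (\<integral>x. (norm (f x))\<^sup>2 \<partial>M) - 2 * (m \<bullet> m) + m \<bullet> m"
  proof -
    have "integrable M (\<lambda>x. f x)" "integrable M (\<lambda>x. f x \<bullet> f x)"
      using assms by (auto intro!: bdd_measurable_integrable bdd_intros)
    then show ?thesis
      by (simp add: power2_norm_eq_inner prob_space m_def)
  qed
  finally show ?thesis
    by (simp add: m_def power2_norm_eq_inner)
qed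

text \<open>The chord bound for \<open>exp\<close> on \<open>[- b, b]\<close> is sharp enough to give the factor
  \<open>1 - s * L\<^sup>2 / 2\<close>, as in Hoeffding's lemma but without taking the logarithm of the integral; a
  Taylor estimate would lose a factor \<open>exp 2\<close> in the quadratic term.\<close>

lemma (in prob_space) exp_linear_gain:
  fixes p :: "'a \<Rightarrow> real" and x :: "'a \<Rightarrow> 'b::euclidean_space"
  assumes p: "bdd_measurable M p" "\<And>z. z \<in> space M \<Longrightarrow> 0 \<le> p z" "(\<integral>z. p z \<partial>M) = 1"
    and x: "x \<in> borel_measurable M" "\<And>z. z \<in> space M \<Longrightarrow> norm (x z) \<le> L"
    and d: "d = (\<integral>z. p z *\<^sub>R x z \<partial>M)"
    and "0 < L" "0 < s" "s * L\<^sup>2 \<le> 2"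
  shows "(\<integral>z. p z * exp (- s * (d \<bullet> x z)) \<partial>M) \<le> 1 - s * (1 - s * L\<^sup>2 / 2) * (norm d)\<^sup>2"
proof (cases "d = 0")
  case True
  then show ?thesis using p by simp
next
  case False
  have bx: "bdd_measurable M x"
    using x by (rule bdd_measurableI)
  define b where "b = s * norm d * L"
  have "0 < b"
    using False assms by (simp add: b_def)
  have z: "\<bar>s * (d \<bullet> x z)\<bar> \<le> b" if "z \<in> space M" for z
  proof -
    have "\<bar>d \<bullet> x z\<bar> \<le> norm d * L"
      using Cauchy_Schwarz_ineq2[of d "x z"] mult_left_mono[OF x(2)[OF that], of "norm d"] by simp
    then show ?thesis
      using \<open>0 < s\<close> by (simp add: b_def abs_mult)
  qed
  have mean: "(\<integral>z. p z * (d \<bullet> x z) \<partial>M) = (norm d)\<^sup>2"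
  proof -
    have "(\<integral>z. p z * (d \<bullet> x z) \<partial>M) = (\<integral>z. d \<bullet> (p z *\<^sub>R x z) \<partial>M)"
      by simp
    also have "\<dots> = d \<bullet> d"
      unfolding d using p bx by (intro integral_inner_right) (auto intro!: bdd_measurable_integrable bdd_intros)
    finally show ?thesis by (simp add: power2_norm_eq_inner)
  qed
  have "(\<integral>z. p z * exp (- s * (d \<bullet> x z)) \<partial>M)
      \<le> (\<integral>z. cosh b * p z - s / b * sinh b * (p z * (d \<bullet> x z)) \<partial>M)"
  proof (intro integral_mono)
    fix z assume "z \<in> space M"
    from mult_left_mono[OF exp_minus_le_chord[OF z[OF this] \<open>0 < b\<close>] p(2)[OF this]]
    show "p z * exp (- s * (d \<bullet> x z)) \<le> cosh b * p z - s / b * sinh b * (p z * (d \<bullet> x z))"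
      by (simp add: algebra_simps)
  qed (use p bx in \<open>auto intro!: bdd_measurable_integrable bdd_intros\<close>)
  also have "\<dots> = cosh b - s / b * sinh b * (norm d)\<^sup>2"
    using p bx by (subst Bochner_Integration.integral_diff) (auto simp: mean intro!: bdd_measurable_integrable bdd_intros)
  also have "s / b * sinh b * (norm d)\<^sup>2 = norm d / L * sinh b"
    using False assms by (simp add: b_def power2_eq_square)
  finally have 1: "(\<integral>z. p z * exp (- s * (d \<bullet> x z)) \<partial>M) \<le> cosh b - norm d / L * sinh b" .
  define r where "r = norm d / L"
  \<comment> \<open>The step-size condition \<open>s * L\<^sup>2 \<le> 2\<close> enters
    here.\<close>
  have "b / 2 \<le> r"
  proof -
    have "b * L = s * L\<^sup>2 * norm d"
      by (simp add: b_def power2_eq_square)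
    also have "\<dots> \<le> 2 * norm d"
      using assms by (intro mult_right_mono) auto
    finally show ?thesis
      using \<open>0 < L\<close> by (simp add: r_def field_simps)
  qed
  \<comment> \<open>Comparing the excess \<open>sinh b - b\<close> instead of \<open>sinh b\<close>
    itself leaves exactly the linear term \<open>r * b\<close> and the quadratic term
    \<open>b\<^sup>2 / 2\<close> of the claimed bound.\<close>
  then have "b / 2 * (sinh b - b) \<le> r * (sinh b - b)"
    using le_sinh[of b] \<open>0 < b\<close> by (intro mult_right_mono) auto
  then have "b / 2 * sinh b - b\<^sup>2 / 2 \<le> r * sinh b - r * b"
    by (simp add: power2_eq_square right_diff_distrib)
  then have "cosh b - r * sinh b \<le> 1 - r * b + b\<^sup>2 / 2"
    using cosh_minus_one_le[of b] \<open>0 < b\<close> by linarith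
  also have "\<dots> = 1 - s * (1 - s * L\<^sup>2 / 2) * (norm d)\<^sup>2"
    using assms by (simp add: b_def r_def power2_eq_square field_simps)
  finally show ?thesis using 1 by (simp add: r_def)
qed

text \<open>The density \<open>1 + w \<bullet> x\<close> has total mass one because \<open>x\<close> is centred, and lies in \<open>[1/2, 3/2]\<close>.
  Jensen's inequality for this density bounds the log-partition function \<open>- a\<close> at \<open>v\<close> from
  below; its convexity in \<open>v\<close>, with gradient \<open>d\<close>, then bounds \<open>d \<bullet> v\<close> from below.\<close>

lemma (in prob_space) exp_tilt_coercive:
  fixes p \<rho> k h :: "'a \<Rightarrow> real" and x :: "'a \<Rightarrow> 'b::euclidean_space"
  assumes "0 < \<epsilon>"
    and x: "bdd_measurable M x" "(\<integral>z. x z \<partial>M) = 0"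
    and h: "bdd_measurable M h" "\<And>z. z \<in> space M \<Longrightarrow> h z \<le> C"
    and k: "bdd_measurable M k" "\<And>z. z \<in> space M \<Longrightarrow> 0 \<le> k z" "\<And>z. z \<in> space M \<Longrightarrow> k z \<le> C"
    and p: "\<And>z. z \<in> space M \<Longrightarrow> p z = exp ((a + v \<bullet> x z + h z - k z) / \<epsilon>)" "(\<integral>z. p z \<partial>M) = 1"
    and d: "d = (\<integral>z. p z *\<^sub>R x z \<partial>M)"
    and w: "\<And>z. z \<in> space M \<Longrightarrow> \<bar>w \<bullet> x z\<bar> \<le> 1 / 2"
    and \<delta>: "(\<integral>z. (w \<bullet> x z) * (v \<bullet> x z) \<partial>M) = \<delta> * norm v"
  shows "\<delta> * norm v - (5 / 2 * C - 3 / 2 * (\<integral>z. h z \<partial>M) + \<epsilon> * ln (3 / 2)) \<le> d \<bullet> v"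
proof -
  have bp: "bdd_measurable M p"
    using h k x by (subst bdd_measurable_cong[OF p(1)]) (auto intro!: bdd_intros)
  \<comment> \<open>The exponent of \<open>p\<close> with \<open>h - k\<close> replaced by its upper
    bound \<open>C\<close>. Hence \<open>p * exp (- s) \<le> 1\<close>, and
    \<open>exp (- s) \<ge> 1 - s\<close> makes the estimate linear in \<open>d\<close>.\<close>
  define s where "s z = (v \<bullet> x z + (a + C)) / \<epsilon>" for z
  have bs: "bdd_measurable M s"
    unfolding s_def using x by (auto intro!: bdd_intros)
  have vx: "(\<integral>z. v \<bullet> x z \<partial>M) = 0"
    using x by (subst integral_inner_right) (auto intro!: bdd_measurable_integrable bdd_intros)
  have wx: "(\<integral>z. w \<bullet> x z \<partial>M) = 0"
    using x by (subst integral_inner_right) (auto intro!: bdd_measurable_integrable bdd_intros)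

  have 1: "- a - C \<le> d \<bullet> v"
  proof -
    have "(\<integral>z. p z * (1 - s z) \<partial>M) \<le> 1"
    proof (intro integral_le_const AE_I2)
      fix z assume z: "z \<in> space M"
      have "p z * (1 - s z) \<le> p z * exp (- s z)"
        using exp_ge_add_one_self[of "- s z"] z p(1) by (intro mult_left_mono) auto
      also have "\<dots> = exp ((h z - k z - C) / \<epsilon>)"
        using z \<open>0 < \<epsilon>\<close> by (simp add: p(1) s_def mult_exp_exp field_simps)
      also have "\<dots> \<le> 1"
        using z h(2)[OF z] k(2)[OF z] \<open>0 < \<epsilon>\<close> by (simp add: divide_nonpos_pos)
      finally show "p z * (1 - s z) \<le> 1" .
    qed (use bp bs in \<open>auto intro!: bdd_measurable_integrable bdd_intros\<close>)
    moreover have "(\<integral>z. p z * (1 - s z) \<partial>M)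
        = (\<integral>z. (1 - (a + C) / \<epsilon>) * p z - (v \<bullet> (p z *\<^sub>R x z)) / \<epsilon> \<partial>M)"
      using \<open>0 < \<epsilon>\<close> by (intro Bochner_Integration.integral_cong) (auto simp: s_def field_simps)
    moreover have "\<dots> = (1 - (a + C) / \<epsilon>) - (v \<bullet> d) / \<epsilon>"
    proof -
      have "(\<integral>z. v \<bullet> (p z *\<^sub>R x z) \<partial>M) = v \<bullet> d"
        unfolding d using bp x by (intro integral_inner_right) (auto intro!: bdd_measurable_integrable bdd_intros)
      then show ?thesis
        using bp x p(2) by (subst Bochner_Integration.integral_diff) (auto intro!: bdd_measurable_integrable bdd_intros)
    qed
    ultimately have "(1 - (a + C) / \<epsilon>) - (v \<bullet> d) / \<epsilon> \<le> 1"
      by linarith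
    then have "0 \<le> (a + C + v \<bullet> d) / \<epsilon>"
      by (simp add: add_divide_distrib)
    then show ?thesis
      using \<open>0 < \<epsilon>\<close> by (simp add: zero_le_divide_iff inner_commute)
  qed

  have 2: "\<delta> * norm v + 3 / 2 * ((\<integral>z. h z \<partial>M) - C) - \<epsilon> * ln (3 / 2) \<le> - a"
  proof -
    \<comment> \<open>The Young inequality \<open>exp l \<ge> \<rho> * (1 + l - ln \<rho>)\<close>
      with \<open>\<rho> = 1 + w \<bullet> x z\<close>, weakened by
      \<open>\<rho> \<le> 3 / 2\<close>. Since \<open>h - C \<le> 0\<close>, its weight
      \<open>\<rho>\<close> may be raised to \<open>3 / 2\<close>, so that only the plain integral
      of \<open>h\<close> remains.\<close>
    define q where "q z = (1 + w \<bullet> x z) * ((a + v \<bullet> x z) / \<epsilon> + (1 - ln (3 / 2))) + 3 / 2 * (h z - C) / \<epsilon>" for z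
    have "(\<integral>z. q z \<partial>M) \<le> (\<integral>z. p z \<partial>M)"
    proof (intro integral_mono)
      fix z assume z: "z \<in> space M"
      define \<rho> where "\<rho> = 1 + w \<bullet> x z"
      have \<rho>: "0 < \<rho>" "\<rho> \<le> 3 / 2"
        using w[OF z] by (auto simp: \<rho>_def abs_le_iff)
      define l where "l = (a + v \<bullet> x z + h z - k z) / \<epsilon>"
      have "\<rho> * ln \<rho> \<le> \<rho> * ln (3 / 2)"
        using \<rho> by (intro mult_left_mono) auto
      moreover have "\<rho> * (1 + (l - ln \<rho>)) \<le> \<rho> * exp (l - ln \<rho>)"
        using \<rho> exp_ge_add_one_self[of "l - ln \<rho>"] by (intro mult_left_mono) auto
      moreover have "\<rho> * exp (l - ln \<rho>) = p z"
        using \<rho> z by (simp add: exp_diff l_def p(1))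
      moreover have "3 / 2 * ((h z - C) / \<epsilon>) \<le> \<rho> * ((h z - C) / \<epsilon>)"
        using \<rho> h(2)[OF z] \<open>0 < \<epsilon>\<close> by (intro mult_right_mono_neg divide_nonpos_pos) auto
      moreover have "\<rho> * ((h z - C) / \<epsilon>) \<le> \<rho> * ((h z - k z) / \<epsilon>)"
        using \<rho> k(3)[OF z] \<open>0 < \<epsilon>\<close> by (intro mult_left_mono divide_right_mono) auto
      moreover have "\<rho> * l = \<rho> * ((a + v \<bullet> x z) / \<epsilon>) + \<rho> * ((h z - k z) / \<epsilon>)"
        by (simp add: l_def add_divide_distrib diff_divide_distrib algebra_simps)
      ultimately show "q z \<le> p z"
        by (simp add: q_def \<rho>_def[symmetric] ring_distribs)
    qed (use bp h x in \<open>auto simp: q_def[abs_def] intro!: bdd_measurable_integrable bdd_intros\<close>)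
    moreover have "(\<integral>z. q z \<partial>M)
       = a / \<epsilon> + (1 - ln (3 / 2)) + \<delta> * norm v / \<epsilon> + 3 / 2 * ((\<integral>z. h z \<partial>M) - C) / \<epsilon>"
    proof -
      have "(\<integral>z. q z \<partial>M) = (\<integral>z. (a / \<epsilon> + (1 - ln (3 / 2)) - 3 / 2 * C / \<epsilon>)
         + (a / \<epsilon> + (1 - ln (3 / 2))) * (w \<bullet> x z) + (v \<bullet> x z) / \<epsilon>
         + (w \<bullet> x z) * (v \<bullet> x z) / \<epsilon> + 3 / 2 * h z / \<epsilon> \<partial>M)"
        unfolding q_def
        by (intro Bochner_Integration.integral_cong refl)
          (simp add: algebra_simps add_divide_distrib diff_divide_distrib)
      also have "\<dots> = (a / \<epsilon> + (1 - ln (3 / 2)) - 3 / 2 * C / \<epsilon>)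
         + (a / \<epsilon> + (1 - ln (3 / 2))) * (\<integral>z. w \<bullet> x z \<partial>M) + (\<integral>z. v \<bullet> x z \<partial>M) / \<epsilon>
         + (\<integral>z. (w \<bullet> x z) * (v \<bullet> x z) \<partial>M) / \<epsilon> + 3 / 2 * (\<integral>z. h z \<partial>M) / \<epsilon>"
      proof -
        have "integrable M (\<lambda>z. w \<bullet> x z)" "integrable M (\<lambda>z. v \<bullet> x z)"
          "integrable M (\<lambda>z. (w \<bullet> x z) * (v \<bullet> x z))" "integrable M h"
          using x h by (auto intro!: bdd_measurable_integrable bdd_intros)
        then show ?thesis
          by (simp add: prob_space)
      qed
      finally show ?thesis
        unfolding vx wx \<delta> by (simp add: algebra_simps diff_divide_distrib)
    qed
    ultimately have "(a + \<delta> * norm v + 3 / 2 * ((\<integral>z. h z \<partial>M) - C) - \<epsilon> * ln (3 / 2)) / \<epsilon> \<le> 0"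
      using p(2) \<open>0 < \<epsilon>\<close> by (simp add: add_divide_distrib diff_divide_distrib)
    then show ?thesis
      using \<open>0 < \<epsilon>\<close> by (simp add: divide_le_0_iff)
  qed
  from 1 2 show ?thesis by argo
qed

subsection \<open>The dual objective and its partial maximizations\<close>

lemma (in prob_space) integral_exp_pos:
  fixes f :: "'a \<Rightarrow> real"
  assumes "bdd_measurable M f"
  shows "0 < (\<integral>x. exp (f x) \<partial>M)"
proof -
  obtain B where B: "\<And>x. x \<in> space M \<Longrightarrow> norm (f x) \<le> B"
    using assms by (rule bdd_measurableE) blast
  have "exp (- B) \<le> exp (f x)" if "x \<in> space M" for x
    using B[OF that] by (simp add: abs_le_iff)
  then have "exp (- B) \<le> (\<integral>x. exp (f x) \<partial>M)"
    using assms by (intro integral_ge_const AE_I2 bdd_measurable_integrable bdd_intros)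
  then show ?thesis
    using exp_gt_zero[of "- B"] by linarith
qed

text \<open>The two spaces will be the supports themselves, so no integral carries a set and
  pointwise claims on the spaces are claims on the supports. A point \<open>z\<close> stands for a
  pair and \<open>x\<close> for its first projection; of the squared distance only a measurable cost
  with values in \<open>[0, C]\<close> is kept.\<close>

locale moment_dual = \<mu>: prob_space \<mu> + \<nu>: prob_space \<nu>
  for \<mu> :: "'u measure" and \<nu> :: "'z measure" +
  fixes x :: "'z \<Rightarrow> 'a::euclidean_space" and c :: "'u \<Rightarrow> 'z \<Rightarrow> real" and \<epsilon> L C :: real
  assumes \<epsilon>_pos: "0 < \<epsilon>"
    and x_measurable: "x \<in> borel_measurable \<nu>"
    and x_bound: "z \<in> space \<nu> \<Longrightarrow> norm (x z) \<le> L"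
    and x_mean: "(\<integral>z. x z \<partial>\<nu>) = 0"
    and c_measurable: "(\<lambda>w. c (fst w) (snd w)) \<in> borel_measurable (\<mu> \<Otimes>\<^sub>M \<nu>)"
    and c_nonneg: "u \<in> space \<mu> \<Longrightarrow> z \<in> space \<nu> \<Longrightarrow> 0 \<le> c u z"
    and c_le: "u \<in> space \<mu> \<Longrightarrow> z \<in> space \<nu> \<Longrightarrow> c u z \<le> C"
begin

sublocale pair: pair_prob_space \<mu> \<nu> ..

lemma bdd_x [bdd_intros]: "bdd_measurable \<nu> x"
  using x_measurable x_bound by (rule bdd_measurableI)

lemma bdd_c: "bdd_measurable (\<mu> \<Otimes>\<^sub>M \<nu>) (\<lambda>w. c (fst w) (snd w))"
  using c_measurable
proof (rule bdd_measurableI)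
  fix w assume "w \<in> space (\<mu> \<Otimes>\<^sub>M \<nu>)"
  then have "fst w \<in> space \<mu>" "snd w \<in> space \<nu>"
    by (auto simp: space_pair_measure)
  then show "norm (c (fst w) (snd w)) \<le> C"
    using c_nonneg c_le by simp
qed

lemma bdd_fst [bdd_intros]: "bdd_measurable \<mu> f \<Longrightarrow> bdd_measurable (\<mu> \<Otimes>\<^sub>M \<nu>) (\<lambda>w. f (fst w))"
  by (erule bdd_measurable_compose) simp

lemma bdd_snd [bdd_intros]: "bdd_measurable \<nu> f \<Longrightarrow> bdd_measurable (\<mu> \<Otimes>\<^sub>M \<nu>) (\<lambda>w. f (snd w))"
  by (erule bdd_measurable_compose) simp

lemma bdd_section1:
  assumes "bdd_measurable (\<mu> \<Otimes>\<^sub>M \<nu>) (\<lambda>w. k (fst w) (snd w))" "u \<in> space \<mu>"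
  shows "bdd_measurable \<nu> (k u)"
proof -
  have "(\<lambda>z. (u, z)) \<in> measurable \<nu> (\<mu> \<Otimes>\<^sub>M \<nu>)"
    using assms(2) by simp
  from bdd_measurable_compose[OF assms(1) this] show ?thesis by simp
qed

lemma bdd_section2:
  assumes "bdd_measurable (\<mu> \<Otimes>\<^sub>M \<nu>) (\<lambda>w. k (fst w) (snd w))" "z \<in> space \<nu>"
  shows "bdd_measurable \<mu> (\<lambda>u. k u z)"
proof -
  have "(\<lambda>u. (u, z)) \<in> measurable \<mu> (\<mu> \<Otimes>\<^sub>M \<nu>)"
    using assms(2) by simp
  from bdd_measurable_compose[OF assms(1) this] show ?thesis by simp
qed

lemma bdd_integral2:
  assumes "bdd_measurable (\<mu> \<Otimes>\<^sub>M \<nu>) (\<lambda>w. k (fst w) (snd w))"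
  shows "bdd_measurable \<mu> (\<lambda>u. \<integral>z. k u z \<partial>\<nu>)"
proof -
  obtain B where B: "\<And>w. w \<in> space (\<mu> \<Otimes>\<^sub>M \<nu>) \<Longrightarrow> norm (k (fst w) (snd w)) \<le> B"
    using assms by (rule bdd_measurableE) blast
  show ?thesis
  proof (rule bdd_measurableI)
    have "case_prod k \<in> borel_measurable (\<mu> \<Otimes>\<^sub>M \<nu>)"
      using assms by (simp add: bdd_measurable_def case_prod_beta')
    then show "(\<lambda>u. \<integral>z. k u z \<partial>\<nu>) \<in> borel_measurable \<mu>"
      by (rule \<nu>.borel_measurable_lebesgue_integral)
    show "norm (\<integral>z. k u z \<partial>\<nu>) \<le> B" if "u \<in> space \<mu>" for u
      using bdd_section1[OF assms that] B[of "(u, _)"] that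
      by (intro \<nu>.norm_integral_le) (auto simp: bdd_measurable_def space_pair_measure)
  qed
qed

lemma bdd_integral1:
  assumes "bdd_measurable (\<mu> \<Otimes>\<^sub>M \<nu>) (\<lambda>w. k (fst w) (snd w))"
  shows "bdd_measurable \<nu> (\<lambda>z. \<integral>u. k u z \<partial>\<mu>)"
proof -
  obtain B where B: "\<And>w. w \<in> space (\<mu> \<Otimes>\<^sub>M \<nu>) \<Longrightarrow> norm (k (fst w) (snd w)) \<le> B"
    using assms by (rule bdd_measurableE) blast
  show ?thesis
  proof (rule bdd_measurableI)
    have "(\<lambda>w. k (fst w) (snd w)) \<in> borel_measurable (\<mu> \<Otimes>\<^sub>M \<nu>)"
      using assms by (simp add: bdd_measurable_def)
    from measurable_compose[OF measurable_pair_swap' this]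
    have "(\<lambda>(z, u). k u z) \<in> borel_measurable (\<nu> \<Otimes>\<^sub>M \<mu>)"
      by (simp add: case_prod_beta')
    then show "(\<lambda>z. \<integral>u. k u z \<partial>\<mu>) \<in> borel_measurable \<nu>"
      by (rule \<mu>.borel_measurable_lebesgue_integral)
    show "norm (\<integral>u. k u z \<partial>\<mu>) \<le> B" if "z \<in> space \<nu>" for z
      using bdd_section2[OF assms that] B[of "(_, z)"] that
      by (intro \<mu>.norm_integral_le) (auto simp: bdd_measurable_def space_pair_measure)
  qed
qed

lemma integral_swap:
  assumes "bdd_measurable (\<mu> \<Otimes>\<^sub>M \<nu>) (\<lambda>w. k (fst w) (snd w))"
  shows "(\<integral>u. \<integral>z. k u z \<partial>\<nu> \<partial>\<mu>) = (\<integral>z. \<integral>u. k u z \<partial>\<mu> \<partial>\<nu>)"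
proof -
  have "integrable (\<mu> \<Otimes>\<^sub>M \<nu>) (\<lambda>w. k (fst w) (snd w))"
    using assms by (rule pair.bdd_measurable_integrable)
  then show ?thesis
    using pair.Fubini_integral[of k] by (simp add: case_prod_beta')
qed

text \<open>If \<open>\<bar>k\<bar> \<le> B\<close>, the integral of \<open>exp k\<close> over a
  probability measure lies between \<open>exp (- B)\<close> and \<open>exp B\<close>, so its
  logarithm inherits the bound \<open>B\<close>.\<close>

lemma bdd_ln_integral_exp1:
  fixes k :: "'u \<Rightarrow> 'z \<Rightarrow> real"
  assumes "bdd_measurable (\<mu> \<Otimes>\<^sub>M \<nu>) (\<lambda>w. k (fst w) (snd w))"
  shows "bdd_measurable \<nu> (\<lambda>z. ln (\<integral>u. exp (k u z) \<partial>\<mu>))"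
proof -
  obtain B where B: "\<And>w. w \<in> space (\<mu> \<Otimes>\<^sub>M \<nu>) \<Longrightarrow> norm (k (fst w) (snd w)) \<le> B"
    using assms by (rule bdd_measurableE) blast
  have e: "bdd_measurable (\<mu> \<Otimes>\<^sub>M \<nu>) (\<lambda>w. exp (k (fst w) (snd w)))"
    using assms by (rule bdd_intros)
  show ?thesis
  proof (rule bdd_measurableI)
    show "(\<lambda>z. ln (\<integral>u. exp (k u z) \<partial>\<mu>)) \<in> borel_measurable \<nu>"
      using bdd_measurable_borel_measurable[OF bdd_integral1[OF e]] by (rule borel_measurable_ln)
    fix z assume z: "z \<in> space \<nu>"
    have i: "integrable \<mu> (\<lambda>u. exp (k u z))"
      by (rule \<mu>.bdd_measurable_integrable) (rule bdd_section2[OF e z])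
    have b: "- B \<le> k u z \<and> k u z \<le> B" if "u \<in> space \<mu>" for u
      using B[of "(u, z)"] that z by (auto simp: space_pair_measure abs_le_iff)
    have "exp (- B) \<le> (\<integral>u. exp (k u z) \<partial>\<mu>)"
      using i b by (intro \<mu>.integral_ge_const AE_I2) auto
    moreover have "(\<integral>u. exp (k u z) \<partial>\<mu>) \<le> exp B"
      using i b by (intro \<mu>.integral_le_const AE_I2) auto
    moreover have "0 < (\<integral>u. exp (k u z) \<partial>\<mu>)"
      using bdd_section2[OF assms z] by (rule \<mu>.integral_exp_pos)
    ultimately show "norm (ln (\<integral>u. exp (k u z) \<partial>\<mu>)) \<le> B"
      using ln_mono[of "exp (- B)" "\<integral>u. exp (k u z) \<partial>\<mu>"] ln_mono[of "\<integral>u. exp (k u z) \<partial>\<mu>" "exp B"]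
      by (simp add: abs_le_iff minus_le_iff)
  qed
qed

lemma bdd_ln_integral_exp2:
  fixes k :: "'u \<Rightarrow> 'z \<Rightarrow> real"
  assumes "bdd_measurable (\<mu> \<Otimes>\<^sub>M \<nu>) (\<lambda>w. k (fst w) (snd w))"
  shows "bdd_measurable \<mu> (\<lambda>u. ln (\<integral>z. exp (k u z) \<partial>\<nu>))"
proof -
  obtain B where B: "\<And>w. w \<in> space (\<mu> \<Otimes>\<^sub>M \<nu>) \<Longrightarrow> norm (k (fst w) (snd w)) \<le> B"
    using assms by (rule bdd_measurableE) blast
  have e: "bdd_measurable (\<mu> \<Otimes>\<^sub>M \<nu>) (\<lambda>w. exp (k (fst w) (snd w)))"
    using assms by (rule bdd_intros)
  show ?thesis
  proof (rule bdd_measurableI)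
    show "(\<lambda>u. ln (\<integral>z. exp (k u z) \<partial>\<nu>)) \<in> borel_measurable \<mu>"
      using bdd_measurable_borel_measurable[OF bdd_integral2[OF e]] by (rule borel_measurable_ln)
    fix u assume u: "u \<in> space \<mu>"
    have i: "integrable \<nu> (\<lambda>z. exp (k u z))"
      by (rule \<nu>.bdd_measurable_integrable) (rule bdd_section1[OF e u])
    have b: "- B \<le> k u z \<and> k u z \<le> B" if "z \<in> space \<nu>" for z
      using B[of "(u, z)"] that u by (auto simp: space_pair_measure abs_le_iff)
    have "exp (- B) \<le> (\<integral>z. exp (k u z) \<partial>\<nu>)"
      using i b by (intro \<nu>.integral_ge_const AE_I2) auto
    moreover have "(\<integral>z. exp (k u z) \<partial>\<nu>) \<le> exp B"
      using i b by (intro \<nu>.integral_le_const AE_I2) auto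
    moreover have "0 < (\<integral>z. exp (k u z) \<partial>\<nu>)"
      using bdd_section1[OF assms u] by (rule \<nu>.integral_exp_pos)
    ultimately show "norm (ln (\<integral>z. exp (k u z) \<partial>\<nu>)) \<le> B"
      using ln_mono[of "exp (- B)" "\<integral>z. exp (k u z) \<partial>\<nu>"] ln_mono[of "\<integral>z. exp (k u z) \<partial>\<nu>" "exp B"]
      by (simp add: abs_le_iff minus_le_iff)
  qed
qed

section \<open>Gibbs densities and partial maximizers of the dual\<close>

definition gibbs :: "('u \<Rightarrow> real) \<Rightarrow> ('u \<Rightarrow> 'a) \<Rightarrow> ('z \<Rightarrow> real) \<Rightarrow> 'u \<Rightarrow> 'z \<Rightarrow> real" where
  "gibbs f g h u z = exp ((f u + g u \<bullet> x z + h z - c u z) / \<epsilon>)"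

definition dual :: "('u \<Rightarrow> real) \<Rightarrow> ('u \<Rightarrow> 'a) \<Rightarrow> ('z \<Rightarrow> real) \<Rightarrow> real" where
  "dual f g h = (\<integral>u. f u \<partial>\<mu>) + (\<integral>z. h z \<partial>\<nu>) - \<epsilon> * ((\<integral>u. \<integral>z. gibbs f g h u z \<partial>\<nu> \<partial>\<mu>) - 1)"

text \<open>Putting zero in place of the potential to be updated leaves the normalizing constant
  that the new potential has to cancel.\<close>

definition h_update :: "('u \<Rightarrow> real) \<Rightarrow> ('u \<Rightarrow> 'a) \<Rightarrow> 'z \<Rightarrow> real" where
  "h_update f g z = - \<epsilon> * ln (\<integral>u. gibbs f g (\<lambda>_. 0) u z \<partial>\<mu>)"

definition f_update :: "('u \<Rightarrow> 'a) \<Rightarrow> ('z \<Rightarrow> real) \<Rightarrow> 'u \<Rightarrow> real" where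
  "f_update g h u = - \<epsilon> * ln (\<integral>z. gibbs (\<lambda>_. 0) g h u z \<partial>\<nu>)"

text \<open>With \<open>f_update\<close> inserted, the density integrates to one for each
  \<open>u\<close>, so this is the mean of \<open>x\<close> under a probability measure depending on
  \<open>u\<close>.\<close>

definition g_drift :: "('u \<Rightarrow> 'a) \<Rightarrow> ('z \<Rightarrow> real) \<Rightarrow> 'u \<Rightarrow> 'a" where
  "g_drift g h u = (\<integral>z. gibbs (f_update g h) g h u z *\<^sub>R x z \<partial>\<nu>)"

lemma gibbs_pos: "0 < gibbs f g h u z"
  by (simp add: gibbs_def)

lemma gibbs_factor_f: "gibbs f g h u z = exp (f u / \<epsilon>) * gibbs (\<lambda>_. 0) g h u z"
  by (simp add: gibbs_def mult_exp_exp add_divide_distrib diff_divide_distrib)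

lemma gibbs_factor_h: "gibbs f g h u z = exp (h z / \<epsilon>) * gibbs f g (\<lambda>_. 0) u z"
  by (simp add: gibbs_def mult_exp_exp add_divide_distrib diff_divide_distrib)

context
  fixes f :: "'u \<Rightarrow> real" and g :: "'u \<Rightarrow> 'a" and h :: "'z \<Rightarrow> real"
  assumes bf: "bdd_measurable \<mu> f" and bg: "bdd_measurable \<mu> g" and bh: "bdd_measurable \<nu> h"
begin

lemma bdd_energy:
  "bdd_measurable (\<mu> \<Otimes>\<^sub>M \<nu>)
    (\<lambda>w. (f (fst w) + g (fst w) \<bullet> x (snd w) + h (snd w) - c (fst w) (snd w)) / \<epsilon>)"
  by (intro bdd_intros bf bg bh bdd_c)

lemma bdd_gibbs: "bdd_measurable (\<mu> \<Otimes>\<^sub>M \<nu>) (\<lambda>w. gibbs f g h (fst w) (snd w))"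
  unfolding gibbs_def by (intro bdd_measurable_exp bdd_energy)

lemma bdd_gibbs_x: "bdd_measurable (\<mu> \<Otimes>\<^sub>M \<nu>) (\<lambda>w. gibbs f g h (fst w) (snd w) *\<^sub>R x (snd w))"
  by (intro bdd_measurable_scaleR bdd_gibbs bdd_snd bdd_x)

end

lemma bdd_h_update:
  assumes "bdd_measurable \<mu> f" "bdd_measurable \<mu> g"
  shows "bdd_measurable \<nu> (h_update f g)"
proof -
  have "bdd_measurable \<nu> (\<lambda>z. ln (\<integral>u. exp ((f u + g u \<bullet> x z + 0 - c u z) / \<epsilon>) \<partial>\<mu>))"
    by (rule bdd_ln_integral_exp1) (rule bdd_energy[OF assms bdd_measurable_const])
  then have "bdd_measurable \<nu> (\<lambda>z. - \<epsilon> * ln (\<integral>u. exp ((f u + g u \<bullet> x z + 0 - c u z) / \<epsilon>) \<partial>\<mu>))"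
    by (rule bdd_measurable_mult[OF bdd_measurable_const])
  then show ?thesis
    unfolding h_update_def[abs_def] gibbs_def .
qed

lemma bdd_f_update:
  assumes "bdd_measurable \<mu> g" "bdd_measurable \<nu> h"
  shows "bdd_measurable \<mu> (f_update g h)"
proof -
  have "bdd_measurable \<mu> (\<lambda>u. ln (\<integral>z. exp ((0 + g u \<bullet> x z + h z - c u z) / \<epsilon>) \<partial>\<nu>))"
    by (rule bdd_ln_integral_exp2) (rule bdd_energy[OF bdd_measurable_const assms])
  then have "bdd_measurable \<mu> (\<lambda>u. - \<epsilon> * ln (\<integral>z. exp ((0 + g u \<bullet> x z + h z - c u z) / \<epsilon>) \<partial>\<nu>))"
    by (rule bdd_measurable_mult[OF bdd_measurable_const])
  then show ?thesis
    unfolding f_update_def[abs_def] gibbs_def .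
qed

lemma bdd_g_drift:
  assumes "bdd_measurable \<mu> g" "bdd_measurable \<nu> h"
  shows "bdd_measurable \<mu> (g_drift g h)"
  unfolding g_drift_def
  by (rule bdd_integral2[OF bdd_gibbs_x[OF bdd_f_update[OF assms] assms]])

lemma integral_gibbs_h_update:
  assumes "bdd_measurable \<mu> f" "bdd_measurable \<mu> g" "z \<in> space \<nu>"
  shows "(\<integral>u. gibbs f g (h_update f g) u z \<partial>\<mu>) = 1"
proof -
  have "0 < (\<integral>u. gibbs f g (\<lambda>_. 0) u z \<partial>\<mu>)"
    unfolding gibbs_def
    using bdd_section2[OF bdd_energy[OF assms(1,2) bdd_measurable_const[of \<nu> 0]] assms(3)]
    by (intro \<mu>.integral_exp_pos) simp
  then show ?thesis
    using \<epsilon>_pos by (simp add: gibbs_factor_h[of f g "h_update f g"] h_update_def exp_minus)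
qed

lemma integral_gibbs_f_update:
  assumes "bdd_measurable \<mu> g" "bdd_measurable \<nu> h" "u \<in> space \<mu>"
  shows "(\<integral>z. gibbs (f_update g h) g h u z \<partial>\<nu>) = 1"
proof -
  have "0 < (\<integral>z. gibbs (\<lambda>_. 0) g h u z \<partial>\<nu>)"
    unfolding gibbs_def
    using bdd_section1[OF bdd_energy[OF bdd_measurable_const[of \<mu> 0] assms(1,2)] assms(3)]
    by (intro \<nu>.integral_exp_pos) simp
  then show ?thesis
    using \<epsilon>_pos by (simp add: gibbs_factor_f[of "f_update g h"] f_update_def exp_minus)
qed

lemma norm_g_drift_le:
  assumes "bdd_measurable \<mu> g" "bdd_measurable \<nu> h" "u \<in> space \<mu>"
  shows "norm (g_drift g h u) \<le> L"
proof -
  let ?p = "gibbs (f_update g h) g h"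
  have bp: "bdd_measurable \<nu> (?p u)"
    by (rule bdd_section1[OF bdd_gibbs[OF bdd_f_update[OF assms(1,2)] assms(1,2)] assms(3)])
  have "norm (g_drift g h u) \<le> (\<integral>z. norm (?p u z *\<^sub>R x z) \<partial>\<nu>)"
    unfolding g_drift_def by (rule integral_norm_bound)
  also have "\<dots> \<le> (\<integral>z. ?p u z * L \<partial>\<nu>)"
  proof (intro integral_mono \<nu>.bdd_measurable_integrable bdd_intros bp)
    show "norm (?p u z *\<^sub>R x z) \<le> ?p u z * L" if "z \<in> space \<nu>" for z
      using x_bound[OF that] gibbs_pos[of "f_update g h" g h u z] by simp
  qed
  also have "\<dots> = L"
    using integral_gibbs_f_update[OF assms] by simp
  finally show ?thesis .
qed

text \<open>The left side is concave in \<open>a\<close> and maximal at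
  \<open>a = - \<epsilon> * ln b\<close>, which is the formula of both exact updates. Applied
  pointwise, it makes them maximizers of the dual.\<close>

lemma exp_affine_le:
  fixes a b :: real
  assumes "0 < b"
  shows "a - \<epsilon> * exp (a / \<epsilon>) * b \<le> - \<epsilon> * ln b - \<epsilon>"
proof -
  have "1 + (a / \<epsilon> + ln b) \<le> exp (a / \<epsilon> + ln b)"
    by (rule exp_ge_add_one_self)
  also have "\<dots> = exp (a / \<epsilon>) * b"
    using assms by (simp add: exp_add)
  finally have "\<epsilon> * (1 + (a / \<epsilon> + ln b)) \<le> \<epsilon> * (exp (a / \<epsilon>) * b)"
    using \<epsilon>_pos by (intro mult_left_mono) auto
  then show ?thesis
    using \<epsilon>_pos by (simp add: algebra_simps)
qed

lemma dual_h_update: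
  assumes "bdd_measurable \<mu> f" "bdd_measurable \<mu> g"
  shows "dual f g (h_update f g) = (\<integral>u. f u \<partial>\<mu>) + (\<integral>z. h_update f g z \<partial>\<nu>)"
proof -
  \<comment> \<open>The \<open>h\<close>-update normalizes the density for each fixed
    \<open>z\<close>, so the integral over \<open>u\<close> must become the inner one.\<close>
  have "(\<integral>u. \<integral>z. gibbs f g (h_update f g) u z \<partial>\<nu> \<partial>\<mu>) = (\<integral>z. \<integral>u. gibbs f g (h_update f g) u z \<partial>\<mu> \<partial>\<nu>)"
    by (rule integral_swap[OF bdd_gibbs[OF assms bdd_h_update[OF assms]]])
  also have "\<dots> = (\<integral>z. 1 \<partial>\<nu>)"
    using integral_gibbs_h_update[OF assms] by (intro Bochner_Integration.integral_cong) auto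
  finally show ?thesis
    by (simp add: dual_def \<nu>.prob_space)
qed

lemma dual_f_update:
  assumes "bdd_measurable \<mu> g" "bdd_measurable \<nu> h"
  shows "dual (f_update g h) g h = (\<integral>u. f_update g h u \<partial>\<mu>) + (\<integral>z. h z \<partial>\<nu>)"
proof -
  have "(\<integral>u. \<integral>z. gibbs (f_update g h) g h u z \<partial>\<nu> \<partial>\<mu>) = (\<integral>u. 1 \<partial>\<mu>)"
    using integral_gibbs_f_update[OF assms] by (intro Bochner_Integration.integral_cong) auto
  then show ?thesis
    by (simp add: dual_def \<mu>.prob_space)
qed

lemma dual_le_h_update:
  assumes "bdd_measurable \<mu> f" "bdd_measurable \<mu> g" "bdd_measurable \<nu> h"
  shows "dual f g h \<le> dual f g (h_update f g)"
proof -
  let ?I = "\<lambda>z. \<integral>u. gibbs f g h u z \<partial>\<mu>"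
  have I: "bdd_measurable \<nu> ?I"
    by (rule bdd_integral1[OF bdd_gibbs[OF assms]])
  have ints: "integrable \<nu> ?I" "integrable \<nu> h" "integrable \<nu> (h_update f g)"
    using I assms bdd_h_update by (auto intro: \<nu>.bdd_measurable_integrable)
  have "(\<integral>z. h z - \<epsilon> * ?I z \<partial>\<nu>) \<le> (\<integral>z. h_update f g z - \<epsilon> \<partial>\<nu>)"
  proof (intro integral_mono)
    fix z assume z: "z \<in> space \<nu>"
    have "0 < (\<integral>u. gibbs f g (\<lambda>_. 0) u z \<partial>\<mu>)"
      unfolding gibbs_def
      using bdd_section2[OF bdd_energy[OF assms(1,2) bdd_measurable_const[of \<nu> 0]] z]
      by (intro \<mu>.integral_exp_pos) simp
    from exp_affine_le[OF this, of "h z"] show "h z - \<epsilon> * ?I z \<le> h_update f g z - \<epsilon>"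
      by (simp add: gibbs_factor_h[of f g h] h_update_def mult.assoc)
  qed (use ints in auto)
  then show ?thesis
    unfolding dual_h_update[OF assms(1,2)] using ints
    by (simp add: dual_def integral_swap[OF bdd_gibbs[OF assms]] \<nu>.prob_space algebra_simps)
qed

lemma dual_le_f_update:
  assumes "bdd_measurable \<mu> f" "bdd_measurable \<mu> g" "bdd_measurable \<nu> h"
  shows "dual f g h \<le> dual (f_update g h) g h"
proof -
  let ?I = "\<lambda>u. \<integral>z. gibbs f g h u z \<partial>\<nu>"
  have I: "bdd_measurable \<mu> ?I"
    by (rule bdd_integral2[OF bdd_gibbs[OF assms]])
  have ints: "integrable \<mu> ?I" "integrable \<mu> f" "integrable \<mu> (f_update g h)"
    using I assms bdd_f_update by (auto intro: \<mu>.bdd_measurable_integrable)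
  have "(\<integral>u. f u - \<epsilon> * ?I u \<partial>\<mu>) \<le> (\<integral>u. f_update g h u - \<epsilon> \<partial>\<mu>)"
  proof (intro integral_mono)
    fix u assume u: "u \<in> space \<mu>"
    have "0 < (\<integral>z. gibbs (\<lambda>_. 0) g h u z \<partial>\<nu>)"
      unfolding gibbs_def
      using bdd_section1[OF bdd_energy[OF bdd_measurable_const[of \<mu> 0] assms(2,3)] u]
      by (intro \<nu>.integral_exp_pos) simp
    from exp_affine_le[OF this, of "f u"] show "f u - \<epsilon> * ?I u \<le> f_update g h u - \<epsilon>"
      by (simp add: gibbs_factor_f[of f g h] f_update_def mult.assoc)
  qed (use ints in auto)
  then show ?thesis
    unfolding dual_f_update[OF assms(2,3)] using ints
    by (simp add: dual_def \<mu>.prob_space algebra_simps)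
qed

text \<open>The linear part of the dual does not involve \<open>g\<close>, so only the exponential
  term changes. At each \<open>u\<close> the step multiplies a probability density by
  \<open>exp (- (\<eta> / \<epsilon>) * (d \<bullet> x))\<close>, where \<open>d\<close> is the mean
  of \<open>x\<close> under that density; \<open>exp_linear_gain\<close> with
  \<open>s = \<eta> / \<epsilon>\<close> gives the gain, which is then integrated over
  \<open>u\<close>.\<close>

lemma dual_gradient_gain:
  assumes g: "bdd_measurable \<mu> g" and h: "bdd_measurable \<nu> h"
    and "0 < L" "0 < \<eta>" "\<eta> * L\<^sup>2 \<le> 2 * \<epsilon>"
  shows "dual (f_update g h) g h + \<eta> * (1 - \<eta> * L\<^sup>2 / (2 * \<epsilon>)) * (\<integral>u. (norm (g_drift g h u))\<^sup>2 \<partial>\<mu>)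
    \<le> dual (f_update g h) (\<lambda>u. g u - \<eta> *\<^sub>R g_drift g h u) h"
proof -
  let ?f = "f_update g h" and ?d = "g_drift g h"
  let ?g = "\<lambda>u. g u - \<eta> *\<^sub>R ?d u"
  have f: "bdd_measurable \<mu> ?f" and d: "bdd_measurable \<mu> ?d"
    using bdd_f_update[OF g h] bdd_g_drift[OF g h] .
  have g': "bdd_measurable \<mu> ?g"
    by (intro bdd_intros g d)
  define k where "k = \<eta> / \<epsilon> * (1 - \<eta> * L\<^sup>2 / (2 * \<epsilon>))"
  have "(\<integral>u. \<integral>z. gibbs ?f ?g h u z \<partial>\<nu> \<partial>\<mu>) \<le> (\<integral>u. 1 - k * (norm (?d u))\<^sup>2 \<partial>\<mu>)"
  proof (intro integral_mono \<mu>.bdd_measurable_integrable)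
    fix u assume u: "u \<in> space \<mu>"
    have "(\<integral>z. gibbs ?f ?g h u z \<partial>\<nu>) = (\<integral>z. gibbs ?f g h u z * exp (- (\<eta> / \<epsilon>) * (?d u \<bullet> x z)) \<partial>\<nu>)"
      by (intro Bochner_Integration.integral_cong refl)
        (simp add: gibbs_def mult_exp_exp inner_diff_left add_divide_distrib diff_divide_distrib)
    also have "\<dots> \<le> 1 - \<eta> / \<epsilon> * (1 - \<eta> / \<epsilon> * L\<^sup>2 / 2) * (norm (?d u))\<^sup>2"
      using assms \<epsilon>_pos u x_bound gibbs_pos[of ?f g h u] integral_gibbs_f_update[OF g h u]
      by (intro \<nu>.exp_linear_gain[OF _ _ _ x_measurable] bdd_section1[OF bdd_gibbs[OF f g h]])
        (auto simp: g_drift_def less_imp_le field_simps)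
    finally show "(\<integral>z. gibbs ?f ?g h u z \<partial>\<nu>) \<le> 1 - k * (norm (?d u))\<^sup>2"
      by (simp add: k_def mult.commute[of 2 \<epsilon>])
  qed (auto intro!: bdd_integral2[OF bdd_gibbs] bdd_intros f g' h d simp: power2_eq_square)
  also have "\<dots> = 1 - k * (\<integral>u. (norm (?d u))\<^sup>2 \<partial>\<mu>)"
  proof -
    have "integrable \<mu> (\<lambda>u. (norm (?d u))\<^sup>2)"
      by (auto intro!: \<mu>.bdd_measurable_integrable bdd_intros d simp: power2_eq_square)
    then show ?thesis
      by (simp add: \<mu>.prob_space)
  qed
  finally have "\<epsilon> * ((\<integral>u. \<integral>z. gibbs ?f ?g h u z \<partial>\<nu> \<partial>\<mu>) - 1) \<le> \<epsilon> * (- k * (\<integral>u. (norm (?d u))\<^sup>2 \<partial>\<mu>))"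
    using \<epsilon>_pos by (intro mult_left_mono) auto
  moreover have "\<epsilon> * k = \<eta> * (1 - \<eta> * L\<^sup>2 / (2 * \<epsilon>))"
    using \<epsilon>_pos by (simp add: k_def)
  ultimately show ?thesis
    unfolding dual_f_update[OF g h] by (simp add: dual_def mult.assoc[symmetric])
qed

text \<open>The bound \<open>1 + s \<le> exp s\<close> is integrated over \<open>u\<close> against
  the normalized density. As \<open>f\<close> and \<open>g\<close> are centred, only
  \<open>h_update f g z\<close> minus the mean cost remains in the exponent.\<close>

lemma h_update_le:
  assumes f: "bdd_measurable \<mu> f" "(\<integral>u. f u \<partial>\<mu>) = 0"
    and g: "bdd_measurable \<mu> g" "(\<integral>u. g u \<partial>\<mu>) = 0" and z: "z \<in> space \<nu>"
  shows "h_update f g z \<le> C"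
proof -
  let ?h = "h_update f g z"
  have bc: "bdd_measurable \<mu> (\<lambda>u. c u z)"
    by (rule bdd_section2[OF bdd_c z])
  have ints: "integrable \<mu> f" "integrable \<mu> g" "integrable \<mu> (\<lambda>u. c u z)"
    using f g bc by (auto intro: \<mu>.bdd_measurable_integrable)
  have "(\<integral>u. 1 + (f u + g u \<bullet> x z + ?h - c u z) / \<epsilon> \<partial>\<mu>) \<le> (\<integral>u. gibbs f g (h_update f g) u z \<partial>\<mu>)"
    unfolding gibbs_def
    by (intro integral_mono \<mu>.bdd_measurable_integrable bdd_intros f g bc exp_ge_add_one_self)
  also have "\<dots> = 1"
    by (rule integral_gibbs_h_update[OF f(1) g(1) z])
  also have "(\<integral>u. 1 + (f u + g u \<bullet> x z + ?h - c u z) / \<epsilon> \<partial>\<mu>) = 1 + (?h - (\<integral>u. c u z \<partial>\<mu>)) / \<epsilon>"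
    using ints f(2) g(2) by (simp add: \<mu>.prob_space)
  finally have "?h \<le> (\<integral>u. c u z \<partial>\<mu>)"
    using \<epsilon>_pos by (simp add: divide_le_0_iff)
  also have "\<dots> \<le> C"
    using ints c_le z by (intro \<mu>.integral_le_const AE_I2) auto
  finally show ?thesis .
qed

text \<open>The same argument over \<open>z\<close>. The term in \<open>g\<close> now vanishes
  because \<open>x\<close> has mean zero, while the integral of \<open>h\<close> stays.\<close>

lemma f_update_le:
  assumes g: "bdd_measurable \<mu> g" and h: "bdd_measurable \<nu> h" and u: "u \<in> space \<mu>"
  shows "f_update g h u \<le> C - (\<integral>z. h z \<partial>\<nu>)"
proof -
  let ?f = "f_update g h u"
  have bc: "bdd_measurable \<nu> (c u)"
    by (rule bdd_section1[OF bdd_c u])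
  have ints: "integrable \<nu> x" "integrable \<nu> h" "integrable \<nu> (c u)"
    using h bc bdd_x by (auto intro: \<nu>.bdd_measurable_integrable)
  have "(\<integral>z. 1 + (?f + g u \<bullet> x z + h z - c u z) / \<epsilon> \<partial>\<nu>) \<le> (\<integral>z. gibbs (f_update g h) g h u z \<partial>\<nu>)"
    unfolding gibbs_def
    by (intro integral_mono \<nu>.bdd_measurable_integrable bdd_intros h bc exp_ge_add_one_self)
  also have "\<dots> = 1"
    by (rule integral_gibbs_f_update[OF g h u])
  also have "(\<integral>z. 1 + (?f + g u \<bullet> x z + h z - c u z) / \<epsilon> \<partial>\<nu>)
      = 1 + (?f + (\<integral>z. h z \<partial>\<nu>) - (\<integral>z. c u z \<partial>\<nu>)) / \<epsilon>"
    using ints x_mean by (simp add: \<nu>.prob_space)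
  finally have "?f \<le> (\<integral>z. c u z \<partial>\<nu>) - (\<integral>z. h z \<partial>\<nu>)"
    using \<epsilon>_pos by (simp add: divide_le_0_iff)
  moreover have "(\<integral>z. c u z \<partial>\<nu>) \<le> C"
    using ints c_le u by (intro \<nu>.integral_le_const AE_I2) auto
  ultimately show ?thesis by simp
qed

end

section \<open>The extended-valued dual and its invariances\<close>

lemma ennreal_integral_le_nn_integral:
  fixes f :: "'a \<Rightarrow> real"
  assumes "integrable M f"
  shows "ennreal (\<integral>x. f x \<partial>M) \<le> (\<integral>\<^sup>+x. ennreal (f x) \<partial>M)"
proof -
  have i: "integrable M (\<lambda>x. max 0 (f x))"
    using assms by simp
  have "ennreal (\<integral>x. f x \<partial>M) \<le> ennreal (\<integral>x. max 0 (f x) \<partial>M)"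
    using assms i by (intro ennreal_leI integral_mono) auto
  also have "\<dots> = (\<integral>\<^sup>+x. ennreal (max 0 (f x)) \<partial>M)"
    using i by (intro nn_integral_eq_integral[symmetric]) auto
  also have "\<dots> = (\<integral>\<^sup>+x. ennreal (f x) \<partial>M)"
    by (intro nn_integral_cong) (auto simp: max_def ennreal_neg)
  finally show ?thesis .
qed

context moment_dual
begin

text \<open>The supremum defining the dual value ranges over integrable potentials, whose
  exponential term may be infinite. On bounded potentials this agrees with the real-valued
  \<open>dual\<close>.\<close>

definition dual_ereal :: "('u \<Rightarrow> real) \<Rightarrow> ('u \<Rightarrow> 'a) \<Rightarrow> ('z \<Rightarrow> real) \<Rightarrow> ereal" where
  "dual_ereal f g h = ereal (\<integral>u. f u \<partial>\<mu>) + ereal (\<integral>z. h z \<partial>\<nu>)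
    - ereal \<epsilon> * (enn2ereal (\<integral>\<^sup>+u. \<integral>\<^sup>+z. ennreal (gibbs f g h u z) \<partial>\<nu> \<partial>\<mu>) - 1)"

lemma dual_ereal_eq:
  assumes "bdd_measurable \<mu> f" "bdd_measurable \<mu> g" "bdd_measurable \<nu> h"
  shows "dual_ereal f g h = ereal (dual f g h)"
proof -
  note b = bdd_gibbs[OF assms]
  have nonneg: "0 \<le> gibbs f g h u z" for u z
    by (simp add: gibbs_pos less_imp_le)
  have "(\<integral>\<^sup>+u. \<integral>\<^sup>+z. ennreal (gibbs f g h u z) \<partial>\<nu> \<partial>\<mu>) = (\<integral>\<^sup>+u. ennreal (\<integral>z. gibbs f g h u z \<partial>\<nu>) \<partial>\<mu>)"
    by (intro nn_integral_cong nn_integral_eq_integral \<nu>.bdd_measurable_integrable bdd_section1[OF b])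
      (auto simp: nonneg)
  also have "\<dots> = ennreal (\<integral>u. \<integral>z. gibbs f g h u z \<partial>\<nu> \<partial>\<mu>)"
    by (intro nn_integral_eq_integral \<mu>.bdd_measurable_integrable bdd_integral2[OF b] AE_I2
        Bochner_Integration.integral_nonneg nonneg)
  finally have "enn2ereal (\<integral>\<^sup>+u. \<integral>\<^sup>+z. ennreal (gibbs f g h u z) \<partial>\<nu> \<partial>\<mu>)
      = ereal (\<integral>u. \<integral>z. gibbs f g h u z \<partial>\<nu> \<partial>\<mu>)"
    by (simp add: nonneg)
  then show ?thesis
    by (simp add: dual_ereal_def dual_def one_ereal_def)
qed

text \<open>Replacing the cost by \<open>C\<close> and \<open>exp s\<close> by \<open>1 + s\<close>
  bounds the exponential term below by a linear one that cancels both integrals; the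
  \<open>g\<close> term disappears because \<open>x\<close> is centred. The bound excludes an
  infinite dual value, which \<open>real_of_ereal\<close> would send to zero.\<close>

lemma dual_ereal_le:
  assumes "integrable \<mu> f" "integrable \<nu> h"
  shows "dual_ereal f g h \<le> ereal C"
proof -
  define I where "I = (\<integral>\<^sup>+u. \<integral>\<^sup>+z. ennreal (gibbs f g h u z) \<partial>\<nu> \<partial>\<mu>)"
  define F H where "F = (\<integral>u. f u \<partial>\<mu>)" and "H = (\<integral>z. h z \<partial>\<nu>)"
  have ix: "integrable \<nu> x"
    by (rule \<nu>.bdd_measurable_integrable[OF bdd_x])
  have "ennreal (1 + (F + H - C) / \<epsilon>) = ennreal (\<integral>u. 1 + (f u + H - C) / \<epsilon> \<partial>\<mu>)"
    using assms by (simp add: F_def \<mu>.prob_space)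
  \<comment> \<open>The affine minorant may be negative and is then cut off at zero by
    \<open>ennreal\<close>, so only an inequality holds.\<close>
  also have "\<dots> \<le> (\<integral>\<^sup>+u. ennreal (1 + (f u + H - C) / \<epsilon>) \<partial>\<mu>)"
    using assms by (intro ennreal_integral_le_nn_integral) auto
  also have "\<dots> \<le> I"
    unfolding I_def
  proof (intro nn_integral_mono)
    fix u assume u: "u \<in> space \<mu>"
    have "ennreal (1 + (f u + H - C) / \<epsilon>) = ennreal (\<integral>z. 1 + (f u + g u \<bullet> x z + h z - C) / \<epsilon> \<partial>\<nu>)"
      using assms ix x_mean by (simp add: H_def \<nu>.prob_space)
    also have "\<dots> \<le> (\<integral>\<^sup>+z. ennreal (1 + (f u + g u \<bullet> x z + h z - C) / \<epsilon>) \<partial>\<nu>)"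
      using assms ix by (intro ennreal_integral_le_nn_integral) auto
    also have "\<dots> \<le> (\<integral>\<^sup>+z. ennreal (gibbs f g h u z) \<partial>\<nu>)"
    proof (intro nn_integral_mono ennreal_leI)
      fix z assume "z \<in> space \<nu>"
      then have "(f u + g u \<bullet> x z + h z - C) / \<epsilon> \<le> (f u + g u \<bullet> x z + h z - c u z) / \<epsilon>"
        using c_le[OF u] \<epsilon>_pos by (intro divide_right_mono) auto
      then show "1 + (f u + g u \<bullet> x z + h z - C) / \<epsilon> \<le> gibbs f g h u z"
        unfolding gibbs_def using exp_ge_add_one_self by (rule order_trans[OF add_left_mono])
    qed
    finally show "ennreal (1 + (f u + H - C) / \<epsilon>) \<le> (\<integral>\<^sup>+z. ennreal (gibbs f g h u z) \<partial>\<nu>)" .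
  qed
  finally have I: "ennreal (1 + (F + H - C) / \<epsilon>) \<le> I" .
  show ?thesis
  proof (cases I)
    case top
    then show ?thesis
      using \<epsilon>_pos by (simp add: dual_ereal_def I_def[symmetric] one_ereal_def)
  next
    case (real r)
    then have "1 + (F + H - C) / \<epsilon> \<le> r"
      using I by (simp add: ennreal_le_iff)
    then have "\<epsilon> * ((F + H - C) / \<epsilon>) \<le> \<epsilon> * (r - 1)"
      using \<epsilon>_pos by (intro mult_left_mono) auto
    then have "F + H - \<epsilon> * (r - 1) \<le> C"
      using \<epsilon>_pos by simp
    then show ?thesis
      using real by (simp add: dual_ereal_def I_def[symmetric] F_def[symmetric] H_def[symmetric] one_ereal_def)
  qed
qed

lemma dual_le:
  assumes "bdd_measurable \<mu> f" "bdd_measurable \<mu> g" "bdd_measurable \<nu> h"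
  shows "dual f g h \<le> C"
  using dual_ereal_le[of f h g] dual_ereal_eq[OF assms] assms
  by (simp add: \<mu>.bdd_measurable_integrable \<nu>.bdd_measurable_integrable)

text \<open>The iterates are prescribed on the spaces only, so each identity between them must be
  transported through the functionals.\<close>

lemma dual_cong:
  assumes "\<And>u. u \<in> space \<mu> \<Longrightarrow> f u = f' u" "\<And>u. u \<in> space \<mu> \<Longrightarrow> g u = g' u"
    and "\<And>z. z \<in> space \<nu> \<Longrightarrow> h z = h' z"
  shows "dual f g h = dual f' g' h'"
proof -
  have "(\<integral>u. f u \<partial>\<mu>) = (\<integral>u. f' u \<partial>\<mu>)" "(\<integral>z. h z \<partial>\<nu>) = (\<integral>z. h' z \<partial>\<nu>)"
    "(\<integral>u. \<integral>z. gibbs f g h u z \<partial>\<nu> \<partial>\<mu>) = (\<integral>u. \<integral>z. gibbs f' g' h' u z \<partial>\<nu> \<partial>\<mu>)"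
    using assms by (auto intro!: Bochner_Integration.integral_cong simp: gibbs_def)
  then show ?thesis
    by (simp add: dual_def)
qed

lemma f_update_cong:
  assumes "\<And>z. z \<in> space \<nu> \<Longrightarrow> h z = h' z"
  shows "f_update g h u = f_update g h' u"
proof -
  have "(\<integral>z. gibbs (\<lambda>_. 0) g h u z \<partial>\<nu>) = (\<integral>z. gibbs (\<lambda>_. 0) g h' u z \<partial>\<nu>)"
    using assms by (intro Bochner_Integration.integral_cong) (auto simp: gibbs_def)
  then show ?thesis
    by (simp add: f_update_def)
qed

text \<open>The exponent is unchanged pointwise. In the linear part the two copies of
  \<open>a\<close> cancel, and \<open>b \<bullet> x\<close> integrates to zero.\<close>

lemma dual_normalize:
  assumes "bdd_measurable \<mu> f" "bdd_measurable \<nu> h"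
  shows "dual (\<lambda>u. f u - a) (\<lambda>u. g u - b) (\<lambda>z. h z + a + b \<bullet> x z) = dual f g h"
proof -
  have "integrable \<mu> f" "integrable \<nu> h" "integrable \<nu> x"
    using assms bdd_x by (auto intro: \<mu>.bdd_measurable_integrable \<nu>.bdd_measurable_integrable)
  moreover have "gibbs (\<lambda>u. f u - a) (\<lambda>u. g u - b) (\<lambda>z. h z + a + b \<bullet> x z) = gibbs f g h"
    by (intro ext) (simp add: gibbs_def inner_diff_left)
  ultimately show ?thesis
    using x_mean by (simp add: dual_def \<mu>.prob_space \<nu>.prob_space)
qed

end

subsection \<open>The iteration\<close>

text \<open>The assumption \<open>tilt\<close> is all that is used of the invertible covariance matrix.\<close>

locale moment_sinkhorn = moment_dual \<mu> \<nu> x c \<epsilon> L C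
  for \<mu> :: "'u measure" and \<nu> :: "'z measure" and x :: "'z \<Rightarrow> 'a::euclidean_space"
    and c \<epsilon> L C +
  fixes \<eta> \<delta> K :: real and f ft :: "nat \<Rightarrow> 'u \<Rightarrow> real" and g gt :: "nat \<Rightarrow> 'u \<Rightarrow> 'a"
    and h ht :: "nat \<Rightarrow> 'z \<Rightarrow> real"
  assumes L_ge_1: "1 \<le> L" and \<eta>_pos: "0 < \<eta>" and \<eta>_less: "\<eta> * L\<^sup>2 < 2 * \<epsilon>" and \<delta>_pos: "0 < \<delta>"
    and tilt: "\<And>v. \<exists>w. (\<forall>z\<in>space \<nu>. \<bar>w \<bullet> x z\<bar> \<le> 1 / 2) \<and> (\<integral>z. (w \<bullet> x z) * (v \<bullet> x z) \<partial>\<nu>) = \<delta> * norm v"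
    and c_osc: "\<And>u v z. u \<in> space \<mu> \<Longrightarrow> v \<in> space \<mu> \<Longrightarrow> z \<in> space \<nu> \<Longrightarrow> \<bar>c u z - c v z\<bar> \<le> K"
    and f0: "bdd_measurable \<mu> (f 0)" "(\<integral>u. f 0 u \<partial>\<mu>) = 0"
    and g0: "bdd_measurable \<mu> (g 0)" "(\<integral>u. g 0 u \<partial>\<mu>) = 0"
    and h0: "bdd_measurable \<nu> (h 0)"
    and ht_Suc: "\<And>t z. z \<in> space \<nu> \<Longrightarrow> ht (Suc t) z = h_update (f t) (g t) z"
    and ft_Suc: "\<And>t u. u \<in> space \<mu> \<Longrightarrow> ft (Suc t) u = f_update (g t) (ht (Suc t)) u"
    and gt_Suc: "\<And>t u. u \<in> space \<mu> \<Longrightarrow> gt (Suc t) u = g t u - \<eta> *\<^sub>R (\<integral>z. gibbs (ft (Suc t)) (g t) (ht (Suc t)) u z *\<^sub>R x z \<partial>\<nu>)"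
    and f_Suc: "\<And>t u. u \<in> space \<mu> \<Longrightarrow> f (Suc t) u = ft (Suc t) u - (\<integral>v. ft (Suc t) v \<partial>\<mu>)"
    and g_Suc: "\<And>t u. u \<in> space \<mu> \<Longrightarrow> g (Suc t) u = gt (Suc t) u - (\<integral>v. gt (Suc t) v \<partial>\<mu>)"
    and h_Suc: "\<And>t z. z \<in> space \<nu> \<Longrightarrow>
      h (Suc t) z = ht (Suc t) z + (\<integral>v. ft (Suc t) v \<partial>\<mu>) + (\<integral>v. gt (Suc t) v \<partial>\<mu>) \<bullet> x z"
begin

text \<open>\<open>H t\<close>, \<open>F t\<close> and \<open>G t\<close> are the tilded iterates
  with index \<open>Suc t\<close>, given by the update formulas as total functions;
  \<open>ht_eq\<close>, \<open>ft_eq\<close> and \<open>gt_eq\<close> identify them on the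
  spaces.\<close>

definition H :: "nat \<Rightarrow> 'z \<Rightarrow> real" where "H t = h_update (f t) (g t)"
definition F :: "nat \<Rightarrow> 'u \<Rightarrow> real" where "F t = f_update (g t) (H t)"
definition d :: "nat \<Rightarrow> 'u \<Rightarrow> 'a" where "d t = g_drift (g t) (H t)"
definition G :: "nat \<Rightarrow> 'u \<Rightarrow> 'a" where "G t u = g t u - \<eta> *\<^sub>R d t u"
definition D :: "nat \<Rightarrow> real" where "D t = dual (f t) (g t) (h t)"

lemma ht_eq: "z \<in> space \<nu> \<Longrightarrow> ht (Suc t) z = H t z"
  by (simp add: ht_Suc H_def)

lemma ft_eq: "u \<in> space \<mu> \<Longrightarrow> ft (Suc t) u = F t u"
  using f_update_cong[of "ht (Suc t)" "H t" "g t" u, OF ht_eq] by (simp add: ft_Suc F_def)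

lemma gt_eq:
  assumes "u \<in> space \<mu>"
  shows "gt (Suc t) u = G t u"
proof -
  have "(\<integral>z. gibbs (ft (Suc t)) (g t) (ht (Suc t)) u z *\<^sub>R x z \<partial>\<nu>) = d t u"
    unfolding d_def g_drift_def
    using ft_eq[OF assms] ht_eq by (intro Bochner_Integration.integral_cong) (auto simp: gibbs_def F_def)
  then show ?thesis
    using assms by (simp add: gt_Suc G_def)
qed

lemma integral_ft: "(\<integral>v. ft (Suc t) v \<partial>\<mu>) = (\<integral>v. F t v \<partial>\<mu>)"
  by (intro Bochner_Integration.integral_cong refl ft_eq)

lemma integral_gt: "(\<integral>v. gt (Suc t) v \<partial>\<mu>) = (\<integral>v. G t v \<partial>\<mu>)"
  by (intro Bochner_Integration.integral_cong refl gt_eq)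

lemma f_eq: "u \<in> space \<mu> \<Longrightarrow> f (Suc t) u = F t u - (\<integral>v. F t v \<partial>\<mu>)"
  by (simp add: f_Suc ft_eq integral_ft)

lemma g_eq: "u \<in> space \<mu> \<Longrightarrow> g (Suc t) u = G t u - (\<integral>v. G t v \<partial>\<mu>)"
  by (simp add: g_Suc gt_eq integral_gt)

lemma h_eq: "z \<in> space \<nu> \<Longrightarrow> h (Suc t) z = H t z + (\<integral>v. F t v \<partial>\<mu>) + (\<integral>v. G t v \<partial>\<mu>) \<bullet> x z"
  by (simp add: h_Suc ht_eq integral_ft integral_gt)

lemma bdd_f_g: "bdd_measurable \<mu> (f t) \<and> bdd_measurable \<mu> (g t)"
proof (induction t)
  case 0
  then show ?case using f0 g0 by simp
next
  case (Suc t)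
  have "bdd_measurable \<nu> (H t)"
    unfolding H_def using Suc by (intro bdd_h_update) auto
  then have "bdd_measurable \<mu> (F t)" "bdd_measurable \<mu> (d t)"
    unfolding F_def d_def using Suc by (auto intro: bdd_f_update bdd_g_drift)
  then have "bdd_measurable \<mu> (\<lambda>u. F t u - (\<integral>v. F t v \<partial>\<mu>))" "bdd_measurable \<mu> (\<lambda>u. G t u - (\<integral>v. G t v \<partial>\<mu>))"
    using Suc by (auto simp: G_def intro!: bdd_intros)
  then show ?case
    using bdd_measurable_cong[of \<mu>, OF f_eq] bdd_measurable_cong[of \<mu>, OF g_eq] by simp
qed

lemma bdd_f: "bdd_measurable \<mu> (f t)" and bdd_g: "bdd_measurable \<mu> (g t)"
  using bdd_f_g by auto

lemma bdd_H: "bdd_measurable \<nu> (H t)"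
  unfolding H_def by (rule bdd_h_update[OF bdd_f bdd_g])

lemma bdd_F: "bdd_measurable \<mu> (F t)"
  unfolding F_def by (rule bdd_f_update[OF bdd_g bdd_H])

lemma bdd_d: "bdd_measurable \<mu> (d t)"
  unfolding d_def by (rule bdd_g_drift[OF bdd_g bdd_H])

lemma bdd_G: "bdd_measurable \<mu> (G t)"
  unfolding G_def by (intro bdd_intros bdd_g bdd_d)

lemma bdd_h: "bdd_measurable \<nu> (h t)"
proof (cases t)
  case 0
  then show ?thesis using h0 by simp
next
  case (Suc s)
  have "bdd_measurable \<nu> (\<lambda>z. H s z + (\<integral>v. F s v \<partial>\<mu>) + (\<integral>v. G s v \<partial>\<mu>) \<bullet> x z)"
    by (intro bdd_intros bdd_H)
  then show ?thesis
    using bdd_measurable_cong[of \<nu>, OF h_eq] Suc by simp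
qed

lemma integral_f: "(\<integral>u. f t u \<partial>\<mu>) = 0"
proof (cases t)
  case (Suc s)
  have "integrable \<mu> (F s)"
    by (rule \<mu>.bdd_measurable_integrable[OF bdd_F])
  moreover have "(\<integral>u. f (Suc s) u \<partial>\<mu>) = (\<integral>u. F s u - (\<integral>v. F s v \<partial>\<mu>) \<partial>\<mu>)"
    by (intro Bochner_Integration.integral_cong refl f_eq)
  ultimately show ?thesis
    by (simp add: Suc \<mu>.prob_space)
qed (use f0 in simp)

lemma integral_g: "(\<integral>u. g t u \<partial>\<mu>) = 0"
proof (cases t)
  case (Suc s)
  have "integrable \<mu> (G s)"
    by (rule \<mu>.bdd_measurable_integrable[OF bdd_G])
  moreover have "(\<integral>u. g (Suc s) u \<partial>\<mu>) = (\<integral>u. G s u - (\<integral>v. G s v \<partial>\<mu>) \<partial>\<mu>)"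
    by (intro Bochner_Integration.integral_cong refl g_eq)
  ultimately show ?thesis
    by (simp add: Suc \<mu>.prob_space)
qed (use g0 in simp)

lemma integral_G: "(\<integral>u. G t u \<partial>\<mu>) = - (\<eta> *\<^sub>R (\<integral>u. d t u \<partial>\<mu>))"
  unfolding G_def
  using \<mu>.bdd_measurable_integrable[OF bdd_g] \<mu>.bdd_measurable_integrable[OF bdd_d] integral_g
  by simp

section \<open>Dual ascent and coercivity along the iteration\<close>

definition \<kappa> :: real where "\<kappa> = 1 - \<eta> * L\<^sup>2 / (2 * \<epsilon>)"

lemma \<kappa>_pos: "0 < \<kappa>"
  using \<eta>_less \<epsilon>_pos by (simp add: \<kappa>_def)

text \<open>The three claims are read off one chain of ascents. After the \<open>h\<close>-update
  the exponential term contributes nothing and \<open>f t\<close> has mean zero, which leaves the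
  integral of \<open>H t\<close>; after the \<open>f\<close>-update the integral of
  \<open>F t\<close> is added; the gradient step gains the squared norm, and recentring preserves
  the value.\<close>

lemma D_step: "D t + \<eta> * \<kappa> * (\<integral>u. (norm (d t u))\<^sup>2 \<partial>\<mu>) \<le> D (Suc t)"
  and D_le_integral_H: "D t \<le> (\<integral>z. H t z \<partial>\<nu>)"
  and D_le_integral_F_H: "D t \<le> (\<integral>u. F t u \<partial>\<mu>) + (\<integral>z. H t z \<partial>\<nu>)"
proof -
  have 1: "D t \<le> dual (f t) (g t) (H t)"
    unfolding D_def H_def by (rule dual_le_h_update[OF bdd_f bdd_g bdd_h])
  moreover have "dual (f t) (g t) (H t) = (\<integral>z. H t z \<partial>\<nu>)"
    unfolding H_def dual_h_update[OF bdd_f bdd_g] by (simp add: integral_f)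
  ultimately show "D t \<le> (\<integral>z. H t z \<partial>\<nu>)" by simp
  have 2: "dual (f t) (g t) (H t) \<le> dual (F t) (g t) (H t)"
    unfolding F_def by (rule dual_le_f_update[OF bdd_f bdd_g bdd_H])
  moreover have "dual (F t) (g t) (H t) = (\<integral>u. F t u \<partial>\<mu>) + (\<integral>z. H t z \<partial>\<nu>)"
    unfolding F_def by (rule dual_f_update[OF bdd_g bdd_H])
  ultimately show "D t \<le> (\<integral>u. F t u \<partial>\<mu>) + (\<integral>z. H t z \<partial>\<nu>)"
    using 1 by simp
  have 3: "dual (F t) (g t) (H t) + \<eta> * \<kappa> * (\<integral>u. (norm (d t u))\<^sup>2 \<partial>\<mu>) \<le> dual (F t) (G t) (H t)"
    unfolding F_def G_def d_def \<kappa>_def using L_ge_1 \<eta>_pos \<eta>_less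
    by (intro dual_gradient_gain[OF bdd_g bdd_H]) auto
  have "D (Suc t) = dual (\<lambda>u. F t u - (\<integral>v. F t v \<partial>\<mu>)) (\<lambda>u. G t u - (\<integral>v. G t v \<partial>\<mu>))
      (\<lambda>z. H t z + (\<integral>v. F t v \<partial>\<mu>) + (\<integral>v. G t v \<partial>\<mu>) \<bullet> x z)"
    unfolding D_def by (intro dual_cong f_eq g_eq h_eq)
  also have "\<dots> = dual (F t) (G t) (H t)"
    by (rule dual_normalize[OF bdd_F bdd_H])
  finally show "D t + \<eta> * \<kappa> * (\<integral>u. (norm (d t u))\<^sup>2 \<partial>\<mu>) \<le> D (Suc t)"
    using 1 2 3 by simp
qed

lemma sum_drift_le: "(\<Sum>s<t. \<eta> * \<kappa> * (\<integral>u. (norm (d s u))\<^sup>2 \<partial>\<mu>)) \<le> D t - D 0"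
proof (induction t)
  case (Suc t)
  then show ?case using D_step[of t] by simp
qed simp

lemma D0_le: "D 0 \<le> D t"
proof -
  have "0 \<le> (\<Sum>s<t. \<eta> * \<kappa> * (\<integral>u. (norm (d s u))\<^sup>2 \<partial>\<mu>))"
    using \<eta>_pos \<kappa>_pos by (intro sum_nonneg mult_nonneg_nonneg) auto
  then show ?thesis
    using sum_drift_le[of t] by simp
qed

lemma D_le: "D t \<le> C"
  unfolding D_def by (rule dual_le[OF bdd_f bdd_g bdd_h])

lemma H_le: "z \<in> space \<nu> \<Longrightarrow> H t z \<le> C"
  unfolding H_def by (rule h_update_le[OF bdd_f integral_f bdd_g integral_g])

lemma integral_H_le: "(\<integral>z. H t z \<partial>\<nu>) \<le> C"
  by (intro \<nu>.integral_le_const \<nu>.bdd_measurable_integrable bdd_H AE_I2 H_le)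

lemma norm_d_le: "u \<in> space \<mu> \<Longrightarrow> norm (d t u) \<le> L"
  unfolding d_def by (rule norm_g_drift_le[OF bdd_g bdd_H])

lemma norm_integral_d_le: "norm (\<integral>u. d t u \<partial>\<mu>) \<le> L"
  using bdd_measurable_borel_measurable[OF bdd_d] norm_d_le by (rule \<mu>.norm_integral_le)

lemma C_nonneg: "0 \<le> C"
proof -
  obtain u z where "u \<in> space \<mu>" "z \<in> space \<nu>"
    using \<mu>.not_empty \<nu>.not_empty by auto
  then show ?thesis
    using c_nonneg[of u z] c_le[of u z] by simp
qed

definition K2 :: real where "K2 = 5 * C - 3 / 2 * D 0 + \<epsilon> * ln (3 / 2)"

lemma K2_nonneg: "0 \<le> K2"
proof -
  have "0 \<le> \<epsilon> * ln (3 / 2)"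
    using \<epsilon>_pos by simp
  then show ?thesis
    using D_le[of 0] C_nonneg by (simp add: K2_def)
qed

lemma drift_coercive:
  assumes "u \<in> space \<mu>"
  shows "\<delta> * norm (g t u) - K2 \<le> d t u \<bullet> g t u"
proof -
  obtain w where w: "\<And>z. z \<in> space \<nu> \<Longrightarrow> \<bar>w \<bullet> x z\<bar> \<le> 1 / 2"
    "(\<integral>z. (w \<bullet> x z) * (g t u \<bullet> x z) \<partial>\<nu>) = \<delta> * norm (g t u)"
    using tilt[of "g t u"] by auto
  have "\<delta> * norm (g t u) - (5 / 2 * C - 3 / 2 * (\<integral>z. H t z \<partial>\<nu>) + \<epsilon> * ln (3 / 2)) \<le> d t u \<bullet> g t u"
  proof (rule \<nu>.exp_tilt_coercive[where p = "gibbs (F t) (g t) (H t) u" and k = "c u" and a = "F t u"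
        and w = w and x = x and h = "H t"])
    show "(\<integral>z. gibbs (F t) (g t) (H t) u z \<partial>\<nu>) = 1"
      unfolding F_def by (rule integral_gibbs_f_update[OF bdd_g bdd_H assms])
    show "d t u = (\<integral>z. gibbs (F t) (g t) (H t) u z *\<^sub>R x z \<partial>\<nu>)"
      by (simp add: d_def g_drift_def F_def)
    show "\<bar>w \<bullet> x z\<bar> \<le> 1 / 2" if "z \<in> space \<nu>" for z
      by (rule w(1)[OF that])
  qed (use assms in \<open>auto simp: gibbs_def \<epsilon>_pos x_mean c_nonneg c_le w(2) H_le intro: bdd_x bdd_H bdd_section1[OF bdd_c]\<close>)
  \<comment> \<open>The integral of \<open>H t\<close> is at least \<open>D t\<close>, hence at
    least \<open>D 0\<close>. The \<open>5 / 2\<close> is \<open>1 + 3 / 2\<close> from the two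
    halves of \<open>exp_tilt_coercive\<close>, and \<open>5 / 2 * C \<le> 5 * C\<close> gives the
    constant \<open>K2\<close>.\<close>
  then show ?thesis
    using D_le_integral_H[of t] D0_le[of t] C_nonneg unfolding K2_def by argo
qed

section \<open>Uniform bounds on the iterates\<close>

context
  fixes Dbar G0 :: real
  assumes Dbar: "\<And>t. D t \<le> Dbar" and G0: "\<forall>u\<in>space \<mu>. norm (g 0 u) \<le> G0"
begin

text \<open>The second entry is the radius required by \<open>drift_step_bound\<close>, the first
  covers the initial function. Outside this radius only the recentrings counted by \<open>S\<close>
  can enlarge the bound.\<close>

definition R :: real where "R = max G0 ((2 * K2 + 6 * \<eta> * max 1 \<delta> * L\<^sup>2) / \<delta>)"

text \<open>\<open>S t\<close> collects the recentrings that are too large to be absorbed by coercivity. There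
  \<open>a \<le> 2 / \<delta> * a\<^sup>2\<close>, so the ascent of the dual bounds it uniformly in \<open>t\<close>.\<close>

definition S :: "nat \<Rightarrow> real" where
  "S t = (\<Sum>s<t. let a = norm (\<integral>u. d s u \<partial>\<mu>) in if \<delta> / 2 \<le> a then \<eta> * a else 0)"

definition Kg :: real where
  "Kg = \<eta> * L + R + 2 * exp (1 / 2) / \<delta> * inverse \<kappa> * (1 + 2 * L / \<delta>) * (Dbar - D 0)"

lemma S_nonneg: "0 \<le> S t"
  unfolding S_def using \<eta>_pos by (intro sum_nonneg) (auto simp: Let_def)

lemma S_le: "S t \<le> 2 / (\<delta> * \<kappa>) * (Dbar - D 0)"
proof -
  have "S t \<le> (\<Sum>s<t. 2 / (\<delta> * \<kappa>) * (\<eta> * \<kappa> * (\<integral>u. (norm (d s u))\<^sup>2 \<partial>\<mu>)))"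
    unfolding S_def
  proof (intro sum_mono)
    fix s
    define a where "a = norm (\<integral>u. d s u \<partial>\<mu>)"
    have a: "a\<^sup>2 \<le> (\<integral>u. (norm (d s u))\<^sup>2 \<partial>\<mu>)"
      unfolding a_def by (rule \<mu>.norm_integral_power2_le[OF bdd_d])
    have "(if \<delta> / 2 \<le> a then \<eta> * a else 0) \<le> 2 / \<delta> * (\<eta> * a\<^sup>2)"
    proof (cases "\<delta> / 2 \<le> a")
      case True
      then have "1 \<le> 2 / \<delta> * a"
        using \<delta>_pos by (simp add: field_simps)
      then have "\<eta> * a * 1 \<le> \<eta> * a * (2 / \<delta> * a)"
        using \<eta>_pos by (intro mult_left_mono) (auto simp: a_def)
      also have "\<eta> * a * (2 / \<delta> * a) = 2 / \<delta> * (\<eta> * a\<^sup>2)"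
        by (simp add: power2_eq_square)
      finally show ?thesis
        by (simp only: True if_True mult_1_right)
    next
      case False
      have "0 \<le> 2 / \<delta> * (\<eta> * a\<^sup>2)"
        using \<eta>_pos \<delta>_pos by simp
      then show ?thesis
        by (simp only: False if_False)
    qed
    also have "\<dots> \<le> 2 / \<delta> * (\<eta> * (\<integral>u. (norm (d s u))\<^sup>2 \<partial>\<mu>))"
      using a \<eta>_pos \<delta>_pos by (intro mult_left_mono) auto
    \<comment> \<open>The factor \<open>\<kappa>\<close> is inserted to match the summands that
      \<open>sum_drift_le\<close> bounds.\<close>
    also have "\<dots> = 2 / (\<delta> * \<kappa>) * (\<eta> * \<kappa> * (\<integral>u. (norm (d s u))\<^sup>2 \<partial>\<mu>))"
      using \<kappa>_pos by simp
    finally show "(let a = norm (\<integral>u. d s u \<partial>\<mu>) in if \<delta> / 2 \<le> a then \<eta> * a else 0)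
      \<le> 2 / (\<delta> * \<kappa>) * (\<eta> * \<kappa> * (\<integral>u. (norm (d s u))\<^sup>2 \<partial>\<mu>))"
      unfolding Let_def a_def .
  qed
  also have "\<dots> = 2 / (\<delta> * \<kappa>) * (\<Sum>s<t. \<eta> * \<kappa> * (\<integral>u. (norm (d s u))\<^sup>2 \<partial>\<mu>))"
    by (rule sum_distrib_left[symmetric])
  also have "\<dots> \<le> 2 / (\<delta> * \<kappa>) * (Dbar - D 0)"
    using \<delta>_pos \<kappa>_pos by (intro mult_left_mono[OF order_trans[OF sum_drift_le diff_right_mono[OF Dbar]]]) simp
  finally show ?thesis .
qed

lemma norm_g_le_S:
  assumes "u \<in> space \<mu>"
  shows "norm (g t u) \<le> R + S t"
proof (induction t)
  case 0
  then show ?case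
    using bspec[OF G0 assms] by (simp add: R_def S_def)
next
  case (Suc t)
  let ?m = "\<integral>u. d t u \<partial>\<mu>"
  have "norm (g t u - \<eta> *\<^sub>R d t u + \<eta> *\<^sub>R ?m) \<le> R + S t + (if \<delta> / 2 \<le> norm ?m then \<eta> * norm ?m else 0)"
    by (rule drift_step_bound[OF norm_d_le[OF assms] norm_integral_d_le L_ge_1 \<eta>_pos \<delta>_pos K2_nonneg S_nonneg
          drift_coercive[OF assms] _ Suc])
      (simp add: R_def)
  \<comment> \<open>Since \<open>g t\<close> has mean zero, the mean of \<open>G t\<close> is minus
    \<open>\<eta>\<close> times the mean of \<open>d t\<close>; subtracting it adds
    \<open>\<eta> *\<^sub>R ?m\<close>.\<close>
  moreover have "g (Suc t) u = g t u - \<eta> *\<^sub>R d t u + \<eta> *\<^sub>R ?m"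
    unfolding g_eq[OF assms] integral_G by (simp add: G_def)
  ultimately show ?case
    by (simp add: S_def Let_def)
qed

text \<open>The summand \<open>\<eta> * L\<close> is set aside for the tilded iterate
  \<open>G t\<close>, which is one uncentred gradient step away from \<open>g t\<close>.\<close>

lemma R_S_le: "\<eta> * L + (R + S t) \<le> Kg"
proof -
  define q where "q = 2 / (\<delta> * \<kappa>) * (Dbar - D 0)"
  have "0 \<le> q"
    unfolding q_def using Dbar[of 0] \<delta>_pos \<kappa>_pos by simp
  \<comment> \<open>The last summand of \<open>Kg\<close> is \<open>q\<close> times a factor that is
    at least one.\<close>
  moreover have "1 * 1 \<le> exp (1 / 2) * (1 + 2 * L / \<delta>)"
    using L_ge_1 \<delta>_pos by (intro mult_mono) auto
  ultimately have "q * (1 * 1) \<le> q * (exp (1 / 2) * (1 + 2 * L / \<delta>))"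
    by (rule mult_left_mono[rotated])
  also have "\<dots> = 2 * exp (1 / 2) / \<delta> * inverse \<kappa> * (1 + 2 * L / \<delta>) * (Dbar - D 0)"
    unfolding q_def divide_inverse inverse_mult_distrib by (simp only: mult_ac)
  finally show ?thesis
    using S_le[of t] by (simp add: Kg_def q_def)
qed

lemma norm_g_le: "u \<in> space \<mu> \<Longrightarrow> norm (g t u) \<le> Kg"
  using norm_g_le_S[of u t] R_S_le[of t] \<eta>_pos L_ge_1 mult_pos_pos[of \<eta> L] by linarith

lemma norm_G_le:
  assumes "u \<in> space \<mu>"
  shows "norm (G t u) \<le> Kg"
proof -
  have "norm (G t u) \<le> norm (g t u) + \<eta> * norm (d t u)"
    unfolding G_def using norm_triangle_ineq4[of "g t u" "\<eta> *\<^sub>R d t u"] \<eta>_pos by simp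
  also have "\<dots> \<le> (R + S t) + \<eta> * L"
    using norm_g_le_S[OF assms] norm_d_le[OF assms] \<eta>_pos by (intro add_mono mult_left_mono) auto
  finally show ?thesis
    using R_S_le[of t] by simp
qed

lemma Kg_nonneg: "0 \<le> Kg"
proof -
  obtain u where "u \<in> space \<mu>"
    using \<mu>.not_empty by auto
  then show ?thesis
    using norm_g_le[of u 0] norm_ge_zero[of "g 0 u"] by linarith
qed

lemma K_nonneg: "0 \<le> K"
proof -
  obtain u z where "u \<in> space \<mu>" "z \<in> space \<nu>"
    using \<mu>.not_empty \<nu>.not_empty by auto
  then show ?thesis
    using c_osc[of u u z] by simp
qed

text \<open>Passing from \<open>u\<close> to \<open>v\<close> changes the exponent, uniformly in
  \<open>z\<close>, by at most the oscillation of the cost plus two inner products bounded by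
  \<open>Kg * L\<close>; a log-integral moves by no more than its exponent.\<close>

lemma F_osc:
  assumes u: "u \<in> space \<mu>" and v: "v \<in> space \<mu>"
  shows "F t u - F t v \<le> K + 2 * Kg * L"
proof -
  define m where "m = K + 2 * Kg * L"
  let ?I = "\<lambda>u. \<integral>z. gibbs (\<lambda>_. 0) (g t) (H t) u z \<partial>\<nu>"
  have b: "bdd_measurable \<nu> (gibbs (\<lambda>_. 0) (g t) (H t) u)" if "u \<in> space \<mu>" for u
    by (rule bdd_section1[OF bdd_gibbs[OF bdd_measurable_const bdd_g bdd_H] that])
  have pos: "0 < ?I u" if "u \<in> space \<mu>" for u
    unfolding gibbs_def
    by (rule \<nu>.integral_exp_pos[OF bdd_section1[OF bdd_energy[OF bdd_measurable_const[of \<mu> 0] bdd_g bdd_H] that]])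
  have "?I v \<le> (\<integral>z. exp (m / \<epsilon>) * gibbs (\<lambda>_. 0) (g t) (H t) u z \<partial>\<nu>)"
  proof (intro integral_mono \<nu>.bdd_measurable_integrable bdd_intros b u v)
    fix z assume z: "z \<in> space \<nu>"
    have "\<bar>g t w \<bullet> x z\<bar> \<le> Kg * L" if "w \<in> space \<mu>" for w
      using Cauchy_Schwarz_ineq2[of "g t w" "x z"] mult_mono[OF norm_g_le[OF that] x_bound[OF z]] Kg_nonneg
      by (meson norm_ge_zero order_trans)
    from this[OF u] this[OF v] have "g t v \<bullet> x z - c v z \<le> m + (g t u \<bullet> x z - c u z)"
      using c_osc[OF u v z] unfolding m_def by linarith
    then have "(0 + g t v \<bullet> x z + H t z - c v z) / \<epsilon> \<le> m / \<epsilon> + (0 + g t u \<bullet> x z + H t z - c u z) / \<epsilon>"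
      using \<epsilon>_pos by (simp add: add_divide_distrib[symmetric] divide_right_mono)
    then show "gibbs (\<lambda>_. 0) (g t) (H t) v z \<le> exp (m / \<epsilon>) * gibbs (\<lambda>_. 0) (g t) (H t) u z"
      unfolding gibbs_def mult_exp_exp exp_le_cancel_iff .
  qed
  also have "\<dots> = exp (m / \<epsilon>) * ?I u"
    by simp
  finally have "ln (?I v) \<le> ln (exp (m / \<epsilon>) * ?I u)"
    using pos[OF u] pos[OF v] by (intro ln_mono) auto
  also have "\<dots> = m / \<epsilon> + ln (?I u)"
    using pos[OF u] by (simp add: ln_mult)
  finally have "\<epsilon> * ln (?I v) \<le> \<epsilon> * (m / \<epsilon> + ln (?I u))"
    using \<epsilon>_pos by (intro mult_left_mono) auto
  then show ?thesis
    unfolding m_def[symmetric] using \<epsilon>_pos by (simp add: F_def f_update_def distrib_left)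
qed

text \<open>As for \<open>F\<close>, but now \<open>f t u\<close> is common to both exponents, and
  two costs in \<open>[0, C]\<close> differ by at most \<open>C\<close>.\<close>

lemma H_osc:
  assumes z: "z \<in> space \<nu>" and z': "z' \<in> space \<nu>"
  shows "H t z - H t z' \<le> C + 2 * Kg * L"
proof -
  define m where "m = C + 2 * Kg * L"
  let ?I = "\<lambda>z. \<integral>u. gibbs (f t) (g t) (\<lambda>_. 0) u z \<partial>\<mu>"
  have b: "bdd_measurable \<mu> (\<lambda>u. gibbs (f t) (g t) (\<lambda>_. 0) u z)" if "z \<in> space \<nu>" for z
    by (rule bdd_section2[OF bdd_gibbs[OF bdd_f bdd_g bdd_measurable_const] that])
  have pos: "0 < ?I z" if "z \<in> space \<nu>" for z
    unfolding gibbs_def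
    by (rule \<mu>.integral_exp_pos[OF bdd_section2[OF bdd_energy[OF bdd_f bdd_g bdd_measurable_const[of \<nu> 0]] that]])
  have "?I z' \<le> (\<integral>u. exp (m / \<epsilon>) * gibbs (f t) (g t) (\<lambda>_. 0) u z \<partial>\<mu>)"
  proof (intro integral_mono \<mu>.bdd_measurable_integrable bdd_intros b z z')
    fix u assume u: "u \<in> space \<mu>"
    have "\<bar>g t u \<bullet> x w\<bar> \<le> Kg * L" if "w \<in> space \<nu>" for w
      using Cauchy_Schwarz_ineq2[of "g t u" "x w"] mult_mono[OF norm_g_le[OF u] x_bound[OF that]] Kg_nonneg
      by (meson norm_ge_zero order_trans)
    from this[OF z] this[OF z'] have "g t u \<bullet> x z' - c u z' \<le> m + (g t u \<bullet> x z - c u z)"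
      using c_le[OF u z] c_nonneg[OF u z'] unfolding m_def by linarith
    then have "(f t u + g t u \<bullet> x z' + 0 - c u z') / \<epsilon> \<le> m / \<epsilon> + (f t u + g t u \<bullet> x z + 0 - c u z) / \<epsilon>"
      using \<epsilon>_pos by (simp add: add_divide_distrib[symmetric] divide_right_mono)
    then show "gibbs (f t) (g t) (\<lambda>_. 0) u z' \<le> exp (m / \<epsilon>) * gibbs (f t) (g t) (\<lambda>_. 0) u z"
      unfolding gibbs_def mult_exp_exp exp_le_cancel_iff .
  qed
  also have "\<dots> = exp (m / \<epsilon>) * ?I z"
    by simp
  finally have "ln (?I z') \<le> ln (exp (m / \<epsilon>) * ?I z)"
    using pos[OF z] pos[OF z'] by (intro ln_mono) auto
  also have "\<dots> = m / \<epsilon> + ln (?I z)"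
    using pos[OF z] by (simp add: ln_mult)
  finally have "\<epsilon> * ln (?I z') \<le> \<epsilon> * (m / \<epsilon> + ln (?I z))"
    using \<epsilon>_pos by (intro mult_left_mono) auto
  then show ?thesis
    unfolding m_def[symmetric] using \<epsilon>_pos by (simp add: H_def h_update_def distrib_left)
qed

text \<open>The first two summands bound the deviation of \<open>F t\<close> from its mean, and
  \<open>C - D 0\<close> bounds the mean.\<close>

definition Kf :: real where "Kf = K + 2 * Kg * L + C - D 0"

text \<open>Above, \<open>f_update_le\<close> is used with the integral of \<open>H t\<close> at
  least \<open>D 0\<close>. Below, the integrals of \<open>F t\<close> and \<open>H t\<close> add up
  to at least \<open>D 0\<close>, and the second is at most \<open>C\<close>.\<close>

lemma abs_integral_F_le: "\<bar>\<integral>u. F t u \<partial>\<mu>\<bar> \<le> C - D 0"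
proof -
  have "F t u \<le> C - D 0" if "u \<in> space \<mu>" for u
    using f_update_le[OF bdd_g bdd_H that, of t t] D_le_integral_H[of t] D0_le[of t]
    by (simp add: F_def)
  then have "(\<integral>u. F t u \<partial>\<mu>) \<le> C - D 0"
    by (intro \<mu>.integral_le_const \<mu>.bdd_measurable_integrable bdd_F AE_I2)
  then show ?thesis
    using D_le_integral_F_H[of t] D0_le[of t] integral_H_le[of t] by simp
qed

lemma abs_F_centered_le:
  assumes "u \<in> space \<mu>"
  shows "\<bar>F t u - (\<integral>v. F t v \<partial>\<mu>)\<bar> \<le> K + 2 * Kg * L"
proof -
  let ?m = "K + 2 * Kg * L"
  have i: "integrable \<mu> (F t)"
    by (rule \<mu>.bdd_measurable_integrable[OF bdd_F])
  have "F t u - ?m \<le> (\<integral>v. F t v \<partial>\<mu>)"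
    using F_osc[OF assms, of _ t] i by (intro \<mu>.integral_ge_const AE_I2) (auto simp: algebra_simps)
  moreover have "(\<integral>v. F t v \<partial>\<mu>) \<le> F t u + ?m"
    using F_osc[OF _ assms, of _ t] i by (intro \<mu>.integral_le_const AE_I2) (auto simp: algebra_simps)
  ultimately show ?thesis by simp
qed

lemma ft_bound: "u \<in> space \<mu> \<Longrightarrow> \<bar>ft (Suc t) u\<bar> \<le> Kf"
  using abs_F_centered_le[of u t] abs_integral_F_le[of t] by (simp add: ft_eq Kf_def)

lemma f_bound: "u \<in> space \<mu> \<Longrightarrow> \<bar>f (Suc t) u\<bar> \<le> Kf"
  using abs_F_centered_le[of u t] D_le[of 0] by (simp add: f_eq Kf_def)

lemma gt_bound: "u \<in> space \<mu> \<Longrightarrow> norm (gt (Suc t) u) \<le> Kg"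
  using norm_G_le by (simp add: gt_eq)

text \<open>The mean of \<open>H t\<close> is at least \<open>D 0\<close>, and no value lies further
  below the mean than the oscillation.\<close>

lemma H_ge:
  assumes "z \<in> space \<nu>"
  shows "D 0 - (C + 2 * Kg * L) \<le> H t z"
proof -
  have "(\<integral>z'. H t z' \<partial>\<nu>) \<le> H t z + (C + 2 * Kg * L)"
    using H_osc[OF _ assms, of _ t]
    by (intro \<nu>.integral_le_const \<nu>.bdd_measurable_integrable bdd_H AE_I2) (auto simp: algebra_simps)
  then show ?thesis
    using D_le_integral_H[of t] D0_le[of t] by simp
qed

lemma Kf_ge: "C - D 0 + 2 * Kg * L \<le> Kf"
  using K_nonneg by (simp add: Kf_def)

lemma ht_bound:
  assumes "z \<in> space \<nu>"
  shows "\<bar>ht (Suc t) z\<bar> \<le> C + 2 * Kf + 2 * Kg * L"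
proof -
  have "0 \<le> Kg * L"
    using Kg_nonneg L_ge_1 by simp
  then show ?thesis
    using H_le[OF assms, of t] H_ge[OF assms, of t] Kf_ge D_le[of 0] C_nonneg
    by (simp add: ht_eq[OF assms] abs_le_iff)
qed

text \<open>One copy of \<open>Kf\<close> covers the lower bound on \<open>H t\<close>, the other
  the mean of \<open>F t\<close> that recentring moves into \<open>h\<close>. The inner product with
  the mean of \<open>G t\<close> is at most \<open>Kg * L\<close>.\<close>

lemma h_bound:
  assumes "z \<in> space \<nu>"
  shows "\<bar>h (Suc t) z\<bar> \<le> C + 2 * Kf + 2 * Kg * L"
proof -
  have "0 \<le> Kg * L"
    using Kg_nonneg L_ge_1 by simp
  moreover have "\<bar>(\<integral>u. G t u \<partial>\<mu>) \<bullet> x z\<bar> \<le> Kg * L"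
  proof -
    have "norm (\<integral>u. G t u \<partial>\<mu>) \<le> Kg"
      using bdd_measurable_borel_measurable[OF bdd_G] norm_G_le by (rule \<mu>.norm_integral_le)
    from mult_mono[OF this x_bound[OF assms] Kg_nonneg norm_ge_zero] show ?thesis
      using Cauchy_Schwarz_ineq2 order_trans by blast
  qed
  ultimately show ?thesis
    using H_le[OF assms, of t] H_ge[OF assms, of t] Kf_ge D_le[of 0] C_nonneg abs_integral_F_le[of t]
    unfolding h_eq[OF assms] abs_le_iff by linarith
qed

end

end

subsection \<open>Supports, cost and covariance\<close>

text \<open>By second countability, the complement of the support is covered by countably many basic
  open null sets.\<close>

lemma AE_msupport:
  fixes M :: "'a::second_countable_topology measure"
  assumes "sets M = sets borel"
  shows "AE x in M. x \<in> msupport M"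
proof -
  obtain B :: "'a set set" where B: "countable B" "topological_basis B"
    using ex_countable_basis by blast
  define N where "N = (\<Union>b\<in>{b\<in>B. emeasure M b = 0}. b)"
  have sets_B: "b \<in> sets M" if "b \<in> B" for b
    using topological_basis_open[OF B(2) that] assms by simp
  have "N \<in> null_sets M"
    unfolding N_def using B(1) sets_B
    by (intro null_sets_UN') (auto intro!: null_setsI countable_subset[of _ B])
  moreover have "{x \<in> space M. x \<notin> msupport M} \<subseteq> N"
  proof
    fix x assume "x \<in> {x \<in> space M. x \<notin> msupport M}"
    then obtain W where W: "open W" "x \<in> W" "emeasure M W = 0"
      by (auto simp: msupport_def)
    then obtain b where b: "b \<in> B" "x \<in> b" "b \<subseteq> W"
      using B(2) topological_basisE by blast
    have "W \<in> sets M"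
      using W(1) assms by simp
    then have "emeasure M b = 0"
      using emeasure_mono[OF b(3)] W(3) by (metis le_zero_eq)
    then show "x \<in> N"
      using b by (auto simp: N_def)
  qed
  ultimately show ?thesis
    by (auto intro: AE_I' simp: eventually_ae_filter)
qed

text \<open>Difference of two squares and the reverse triangle inequality. Averaging the norms of
  \<open>u\<close> and \<open>v\<close> is what lets a single supremum over each support suffice in
  the constant \<open>L\<^sub>c\<close>.\<close>

lemma cost_diff_le:
  "\<bar>cost u y - cost v y\<bar> \<le> norm (u - v) * ((norm u + norm v) / 2 + norm y)"
proof -
  have "\<bar>(norm (u - y))\<^sup>2 - (norm (v - y))\<^sup>2\<bar> = \<bar>norm (u - y) - norm (v - y)\<bar> * (norm (u - y) + norm (v - y))"
    by (simp add: power2_eq_square square_diff_square_factored abs_mult mult.commute)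
  also have "\<dots> \<le> norm (u - v) * ((norm u + norm y) + (norm v + norm y))"
    using norm_triangle_ineq3[of "u - y" "v - y"] norm_triangle_ineq4[of u y] norm_triangle_ineq4[of v y]
    by (intro mult_mono add_mono) auto
  finally show ?thesis
    by (simp add: cost_def algebra_simps abs_le_iff add_divide_distrib diff_divide_distrib)
qed

lemma matrix_inv_right:
  fixes A :: "real ^ 'n ^ 'n"
  assumes "invertible A"
  shows "A ** matrix_inv A = mat 1"
proof -
  have "\<exists>A'. A ** A' = mat 1 \<and> A' ** A = mat 1"
    using assms by (simp only: invertible_def)
  from someI_ex[OF this] show ?thesis
    unfolding matrix_inv_def by (rule conjunct1)
qed

lemma (in prob_space) second_moment_form:
  fixes x :: "'a \<Rightarrow> real ^ 'n"
  assumes x: "bdd_measurable M x" and \<Sigma>: "\<Sigma> = (\<chi> i j. \<integral>z. x z $ i * x z $ j \<partial>M)"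
  shows "(\<integral>z. (w \<bullet> x z) * (v \<bullet> x z) \<partial>M) = v \<bullet> (\<Sigma> *v w)"
proof -
  have b: "bdd_measurable M (\<lambda>z. x z $ i)" for i
    using bdd_measurable_inner[OF x bdd_measurable_const[of M "axis i 1"]] by (simp only: inner_axis inner_real_def mult_1_right)
  have i: "integrable M (\<lambda>z. x z $ i * x z $ j)" for i j
    by (intro bdd_measurable_integrable bdd_measurable_mult b)
  have pointwise: "(w \<bullet> y) * (v \<bullet> y) = (\<Sum>i\<in>UNIV. \<Sum>j\<in>UNIV. (w $ i * v $ j) * (y $ i * y $ j))" for y
    unfolding inner_vec_def sum_product inner_real_def
    by (intro sum.cong refl) (simp only: mult.assoc mult.left_commute)
  have i': "integrable M (\<lambda>z. (w $ i * v $ j) * (x z $ i * x z $ j))" for i j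
    by (intro integrable_mult_right i)
  have "(\<integral>z. (w \<bullet> x z) * (v \<bullet> x z) \<partial>M)
      = (\<Sum>i\<in>UNIV. \<integral>z. (\<Sum>j\<in>UNIV. (w $ i * v $ j) * (x z $ i * x z $ j)) \<partial>M)"
    unfolding pointwise by (rule Bochner_Integration.integral_sum) (rule Bochner_Integration.integrable_sum[OF i'])
  also have "\<dots> = (\<Sum>i\<in>UNIV. \<Sum>j\<in>UNIV. \<integral>z. (w $ i * v $ j) * (x z $ i * x z $ j) \<partial>M)"
    by (intro sum.cong refl Bochner_Integration.integral_sum i')
  also have "\<dots> = (\<Sum>i\<in>UNIV. \<Sum>j\<in>UNIV. (w $ i * v $ j) * (\<integral>z. x z $ i * x z $ j \<partial>M))"
    by (intro sum.cong refl integral_mult_right_zero)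
  also have "\<dots> = (\<Sum>j\<in>UNIV. \<Sum>i\<in>UNIV. (w $ i * v $ j) * (\<Sigma> $ i $ j))"
    by (subst sum.swap) (simp add: \<Sigma>)
  also have "\<dots> = (\<Sum>j\<in>UNIV. \<Sum>i\<in>UNIV. v $ j * (\<Sigma> $ j $ i * w $ i))"
  proof (intro sum.cong refl)
    fix i j
    have "\<Sigma> $ i $ j = \<Sigma> $ j $ i"
      by (simp add: \<Sigma> mult.commute)
    then show "(w $ i * v $ j) * (\<Sigma> $ i $ j) = v $ j * (\<Sigma> $ j $ i * w $ i)"
      by (simp only: mult_ac)
  qed
  also have "\<dots> = v \<bullet> (\<Sigma> *v w)"
    by (simp add: inner_vec_def matrix_vector_mult_def sum_distrib_left)
  finally show ?thesis .
qed

text \<open>This is the origin of \<open>\<delta>\<close>: it is the largest multiple of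
  \<open>?A *v e\<close> whose norm is guaranteed to be at most \<open>1 / (2 * L)\<close> by the
  operator norm, and \<open>\<Sigma>\<close> maps this multiple back to
  \<open>\<delta> *\<^sub>R e\<close>.\<close>

lemma (in prob_space) second_moment_tilt:
  fixes x :: "'a \<Rightarrow> real ^ 'n"
  assumes x: "bdd_measurable M x" "\<And>z. z \<in> space M \<Longrightarrow> norm (x z) \<le> L" and "0 < L"
    and \<Sigma>: "\<Sigma> = (\<chi> i j. \<integral>z. x z $ i * x z $ j \<partial>M)" "invertible \<Sigma>"
    and \<delta>: "\<delta> = 1 / (2 * onorm ((*v) (matrix_inv \<Sigma>)) * L)"
  shows "0 < \<delta>"
    and "\<exists>w. (\<forall>z\<in>space M. \<bar>w \<bullet> x z\<bar> \<le> 1 / 2) \<and> (\<integral>z. (w \<bullet> x z) * (v \<bullet> x z) \<partial>M) = \<delta> * norm v"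
proof -
  let ?A = "matrix_inv \<Sigma>"
  have inv: "\<Sigma> *v (?A *v e) = e" for e
    by (simp add: matrix_vector_mul_assoc matrix_inv_right[OF \<Sigma>(2)])
  have bl: "bounded_linear ((*v) ?A)"
    by (rule matrix_vector_mul_bounded_linear)
  \<comment> \<open>Some nonzero vector is needed to see that the operator norm is not zero;
    otherwise \<open>\<delta>\<close> would be the default value of a division by zero.\<close>
  have "?A *v axis undefined 1 \<noteq> 0"
    using inv[of "axis undefined 1"] by auto
  then have "onorm ((*v) ?A) \<noteq> 0"
    using onorm_eq_0[OF bl] by auto
  then have o: "0 < onorm ((*v) ?A)"
    using onorm_pos_le[OF bl] by simp
  then show "0 < \<delta>"
    using \<open>0 < L\<close> by (simp add: \<delta>)
  \<comment> \<open>For \<open>v = 0\<close> the division gives \<open>e = 0\<close>, and both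
    properties still hold.\<close>
  define e where "e = v /\<^sub>R norm v"
  have e: "norm e \<le> 1" "v \<bullet> e = norm v"
    by (cases "v = 0"; simp add: e_def power2_norm_eq_inner[symmetric] power2_eq_square)+
  define w where "w = \<delta> *\<^sub>R (?A *v e)"
  have "norm (?A *v e) \<le> onorm ((*v) ?A) * norm e"
    by (rule onorm[OF bl])
  also have "\<dots> \<le> onorm ((*v) ?A)"
    using e(1) o by (simp add: mult_left_le)
  finally have "norm w \<le> \<delta> * onorm ((*v) ?A)"
    using \<open>0 < \<delta>\<close> by (simp add: w_def)
  then have w: "norm w \<le> 1 / (2 * L)"
    using o \<open>0 < L\<close> by (simp add: \<delta>)
  have "\<bar>w \<bullet> x z\<bar> \<le> 1 / 2" if "z \<in> space M" for z
  proof -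
    have "\<bar>w \<bullet> x z\<bar> \<le> norm w * norm (x z)"
      by (rule Cauchy_Schwarz_ineq2)
    also have "\<dots> \<le> 1 / (2 * L) * L"
      using w x(2)[OF that] \<open>0 < L\<close> by (intro mult_mono) auto
    finally show ?thesis
      using \<open>0 < L\<close> by simp
  qed
  moreover have "(\<integral>z. (w \<bullet> x z) * (v \<bullet> x z) \<partial>M) = \<delta> * norm v"
    unfolding second_moment_form[OF x(1) \<Sigma>(1)] using e(2)
    by (simp add: w_def matrix_vector_mult_scaleR inv)
  ultimately show "\<exists>w. (\<forall>z\<in>space M. \<bar>w \<bullet> x z\<bar> \<le> 1 / 2) \<and> (\<integral>z. (w \<bullet> x z) * (v \<bullet> x z) \<partial>M) = \<delta> * norm v"
    by blast
qed

section \<open>Restriction of measures to the supports\<close>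

lemma integral_restrict_space_eq_set_integral:
  fixes k :: "'a \<Rightarrow> 'b::{banach, second_countable_topology}"
  assumes "A \<in> sets M"
  shows "(\<integral>x. k x \<partial>restrict_space M A) = (LINT x:A|M. k x)"
  using assms by (simp add: integral_restrict_space set_lebesgue_integral_def)

lemma integrable_restrict_space_iff_set_integrable:
  fixes k :: "'a \<Rightarrow> 'b::{banach, second_countable_topology}"
  assumes "A \<in> sets M"
  shows "integrable (restrict_space M A) k \<longleftrightarrow> set_integrable M A k"
  using assms by (simp add: integrable_restrict_space set_integrable_def)

lemma prob_space_restrict_space_AE:
  assumes "prob_space M" "A \<in> sets M" "AE x in M. x \<in> A"
  shows "prob_space (restrict_space M A)"
proof (rule prob_space_restrict_space[OF assms(2)])
  show "emeasure M A = 1"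
    by (rule prob_space.emeasure_eq_1_AE[OF assms])
qed

lemma bdd_measurable_continuous:
  fixes k :: "'a::topological_space \<Rightarrow> 'b::euclidean_space"
  assumes "compact A" "continuous_on A k" "sets M = sets borel"
  shows "bdd_measurable (restrict_space M A) k"
proof -
  have "space M = UNIV"
    using assms(3) sets_eq_imp_space_eq[of M borel] by simp
  obtain B where "\<And>a. a \<in> A \<Longrightarrow> norm (k a) \<le> B"
    using compact_imp_bounded[OF compact_continuous_image[OF assms(2,1)]] by (auto simp: bounded_iff)
  moreover have "k \<in> borel_measurable (restrict_space M A)"
    using borel_measurable_continuous_on_restrict[OF assms(2)]
    by (simp cong: measurable_cong_sets add: sets_restrict_space_cong[OF assms(3)])
  ultimately show ?thesis
    by (intro bdd_measurableI[where B = B]) (auto simp: space_restrict_space \<open>space M = UNIV\<close>)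
qed

lemma nn_integral_gibbs_restrict:
  fixes f :: "'b::euclidean_space \<Rightarrow> real" and g :: "'b \<Rightarrow> 'a::euclidean_space" and h :: "'a \<times> 'b \<Rightarrow> real"
  assumes "sigma_finite_measure \<nu>" and sets: "sets \<mu> = sets borel" "sets \<nu> = sets borel"
    and A: "U \<in> sets \<mu>" "S \<in> sets \<nu>"
    and f: "set_integrable \<mu> U f" and g: "set_integrable \<mu> U g" and h: "set_integrable \<nu> S h"
  shows "(\<integral>\<^sup>+w\<in>U \<times> S. (case w of (u, (x, y)) \<Rightarrow>
           ennreal (exp ((f u + g u \<bullet> x + h (x, y) - cost u y) / \<epsilon>))) \<partial>(\<mu> \<Otimes>\<^sub>M \<nu>))
    = (\<integral>\<^sup>+u. \<integral>\<^sup>+z. ennreal (exp ((f u + g u \<bullet> fst z + h z - cost u (snd z)) / \<epsilon>))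
         \<partial>restrict_space \<nu> S \<partial>restrict_space \<mu> U)"
proof -
  interpret \<nu>: sigma_finite_measure \<nu> by fact
  \<comment> \<open>Set integrability gives measurability of the extensions by zero only, so these
    replace \<open>f\<close>, \<open>g\<close>, \<open>h\<close> before Tonelli's theorem is
    applied.\<close>
  define f' g' h' where "f' u = indicator U u *\<^sub>R f u" and "g' u = indicator U u *\<^sub>R g u"
    and "h' z = indicator S z *\<^sub>R h z" for u z
  have [measurable]: "f' \<in> borel_measurable \<mu>" "g' \<in> borel_measurable \<mu>" "h' \<in> borel_measurable \<nu>"
    using f g h by (auto simp: set_integrable_def f'_def[abs_def] g'_def[abs_def] h'_def[abs_def])
  have [measurable]: "(\<lambda>u. u) \<in> borel_measurable \<mu>" "fst \<in> borel_measurable \<nu>" "snd \<in> borel_measurable \<nu>"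
    using sets by (auto simp: measurable_cong_sets[OF sets(1) refl] measurable_cong_sets[OF sets(2) refl]
        borel_prod[symmetric])
  note [measurable] = A
  define E where "E w = ennreal (exp ((f' (fst w) + g' (fst w) \<bullet> fst (snd w) + h' (snd w)
      - (norm (fst w - snd (snd w)))\<^sup>2 / 2) / \<epsilon>)) * indicator (U \<times> S) w" for w
  have E: "E \<in> borel_measurable (\<mu> \<Otimes>\<^sub>M \<nu>)"
    unfolding E_def by measurable
  have "(\<integral>\<^sup>+w\<in>U \<times> S. (case w of (u, (x, y)) \<Rightarrow>
           ennreal (exp ((f u + g u \<bullet> x + h (x, y) - cost u y) / \<epsilon>))) \<partial>(\<mu> \<Otimes>\<^sub>M \<nu>)) = (\<integral>\<^sup>+w. E w \<partial>(\<mu> \<Otimes>\<^sub>M \<nu>))"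
    by (intro nn_integral_cong) (auto simp: E_def f'_def g'_def h'_def cost_def split: split_indicator)
  also have "\<dots> = (\<integral>\<^sup>+u. \<integral>\<^sup>+z. E (u, z) \<partial>\<nu> \<partial>\<mu>)"
    by (rule \<nu>.nn_integral_fst[OF E, symmetric])
  also have "\<dots> = (\<integral>\<^sup>+u. (\<integral>\<^sup>+z. ennreal (exp ((f u + g u \<bullet> fst z + h z - cost u (snd z)) / \<epsilon>))
         * indicator S z \<partial>\<nu>) * indicator U u \<partial>\<mu>)"
  proof (intro nn_integral_cong)
    fix u
    show "(\<integral>\<^sup>+z. E (u, z) \<partial>\<nu>) = (\<integral>\<^sup>+z. ennreal (exp ((f u + g u \<bullet> fst z + h z - cost u (snd z)) / \<epsilon>))
         * indicator S z \<partial>\<nu>) * indicator U u"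
    proof (cases "u \<in> U")
      case True
      then show ?thesis
        by (auto simp: E_def f'_def g'_def h'_def cost_def intro!: nn_integral_cong split: split_indicator)
    qed (simp add: E_def)
  qed
  also have "\<dots> = (\<integral>\<^sup>+u. \<integral>\<^sup>+z. ennreal (exp ((f u + g u \<bullet> fst z + h z - cost u (snd z)) / \<epsilon>))
         \<partial>restrict_space \<nu> S \<partial>restrict_space \<mu> U)"
    using A by (simp add: nn_integral_restrict_space)
  finally show ?thesis .
qed

lemma integral_restrict_space_distr:
  fixes k :: "'b::topological_space \<Rightarrow> 'c::{banach, second_countable_topology}"
  assumes \<phi>: "\<phi> \<in> borel_measurable M" and A: "A \<in> sets borel" "AE z in distr M borel \<phi>. z \<in> A"
    and k: "k \<in> borel_measurable borel"
  shows "(\<integral>z. k z \<partial>restrict_space (distr M borel \<phi>) A) = (\<integral>\<omega>. k (\<phi> \<omega>) \<partial>M)"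
proof -
  have "(\<integral>z. k z \<partial>restrict_space (distr M borel \<phi>) A) = (\<integral>z. indicator A z *\<^sub>R k z \<partial>distr M borel \<phi>)"
    using A(1) by (intro integral_restrict_space) simp
  also have "\<dots> = (\<integral>z. k z \<partial>distr M borel \<phi>)"
    using A k by (intro integral_cong_AE) auto
  also have "\<dots> = (\<integral>\<omega>. k (\<phi> \<omega>) \<partial>M)"
    by (rule integral_distr[OF \<phi> k])
  finally show ?thesis .
qed

lemma norm_image_bdd_above:
  fixes A :: "'a::real_normed_vector set"
  assumes "compact A"
  shows "bdd_above (norm ` A)"
  using compact_imp_bounded[OF assms] by (auto simp: bounded_iff bdd_above_def)

theorem proposition4p1:
  fixes P :: "'w measure"
    and X :: "'w \<Rightarrow> real ^ 'dx" and Y :: "'w \<Rightarrow> real ^ 'dy"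
    and \<nu> :: "((real ^ 'dx) \<times> (real ^ 'dy)) measure"
    and \<mu> :: "(real ^ 'dy) measure"
    and UU YY :: "(real ^ 'dy) set" and XX :: "(real ^ 'dx) set"
    and \<Sigma> :: "real ^ 'dx ^ 'dx"
    and \<epsilon> \<eta> M\<^sub>x c_sup L\<^sub>c \<delta> D\<^sub>0 Dbar Kg2 Kg Kf :: real
    and f ft :: "nat \<Rightarrow> real ^ 'dy \<Rightarrow> real"
    and g gt :: "nat \<Rightarrow> real ^ 'dy \<Rightarrow> real ^ 'dx"
    and h ht :: "nat \<Rightarrow> (real ^ 'dx) \<times> (real ^ 'dy) \<Rightarrow> real"
  assumes "prob_space P" and "X \<in> borel_measurable P" and "Y \<in> borel_measurable P"
    and "\<nu> = distr P borel (\<lambda>\<omega>. (X \<omega>, Y \<omega>))"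
    and "prob_space \<mu>" and "sets \<mu> = sets borel"
    and "UU = msupport \<mu>" and "XX = msupport (distr P borel X)" and "YY = msupport (distr P borel Y)"
    and "compact UU" and "compact XX" and "compact YY"
    and "(LINT \<omega>|P. X \<omega>) = 0"
    and "\<Sigma> = (\<chi> i j. LINT \<omega>|P. X \<omega> $ i * X \<omega> $ j)" and "invertible \<Sigma>"
    and "\<epsilon> > 0"
    and "M\<^sub>x = (SUP x\<in>XX. norm x)"
    and "c_sup = (SUP (u, y)\<in>UU \<times> YY. cost u y)"
    and "L\<^sub>c = (SUP u\<in>UU. norm u) + (SUP y\<in>YY. norm y)"
    and "M\<^sub>x \<ge> 1" and "0 < \<eta>" and "\<eta> < 2 * \<epsilon> / M\<^sub>x\<^sup>2"
    and "f 0 \<in> C_diamond UU \<mu>" and "g 0 \<in> C_diamond UU \<mu>" and "continuous_on (XX \<times> YY) (h 0)"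
    and "modified_sinkhorn UU (XX \<times> YY) \<mu> \<nu> \<epsilon> \<eta> f g h ft gt ht"
    and "D\<^sub>0 = real_of_ereal (dual_objective UU (XX \<times> YY) \<mu> \<nu> \<epsilon> (f 0) (g 0) (h 0))"
    and "Dbar = real_of_ereal (dual_value UU (XX \<times> YY) \<mu> \<nu> \<epsilon>)"
    and "\<delta> = 1 / (2 * onorm ((*v) (matrix_inv \<Sigma>)) * M\<^sub>x)"
    and "Kg2 = 5 * c_sup - 3 / 2 * D\<^sub>0 + \<epsilon> * ln (3 / 2)"
    and "Kg = \<eta> * M\<^sub>x
           + max (real_of_ereal (sup_norm UU (g 0))) ((2 * Kg2 + 6 * \<eta> * max 1 \<delta> * M\<^sub>x\<^sup>2) / \<delta>)
           + 2 * exp (1 / 2) / \<delta> * inverse (1 - \<eta> * M\<^sub>x\<^sup>2 / (2 * \<epsilon>)) * (1 + 2 * M\<^sub>x / \<delta>) * (Dbar - D\<^sub>0)"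
    and "Kf = L\<^sub>c * diameter UU + 2 * Kg * M\<^sub>x + c_sup - D\<^sub>0"
  shows "\<forall>t.
       max (sup_norm UU (gt (Suc t))) (sup_norm UU (g (Suc t))) \<le> ereal Kg
     \<and> max (sup_norm UU (ft (Suc t))) (sup_norm UU (f (Suc t))) \<le> ereal Kf
     \<and> max (sup_norm (XX \<times> YY) (ht (Suc t))) (sup_norm (XX \<times> YY) (h (Suc t)))
         \<le> ereal (c_sup + 2 * Kf + 2 * Kg * M\<^sub>x)"
proof -
  note \<nu>_def = assms(4) and sets_\<mu> = assms(6)
  note compact = assms(10,11,12)
  interpret P: prob_space P by fact
  interpret \<mu>: prob_space \<mu> by fact
  define SS where "SS = XX \<times> YY"
  have XY: "(\<lambda>\<omega>. (X \<omega>, Y \<omega>)) \<in> borel_measurable P"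
    using assms(2,3) by (rule borel_measurable_Pair)
  have sets_\<nu>: "sets \<nu> = sets borel"
    by (simp add: \<nu>_def)
  interpret \<nu>: prob_space \<nu>
    unfolding \<nu>_def using XY by (rule P.prob_space_distr)
  have spaces: "space \<mu> = UNIV" "space \<nu> = UNIV"
    using sets_eq_imp_space_eq[OF sets_\<mu>] sets_eq_imp_space_eq[OF sets_\<nu>] by simp_all
  have "compact SS"
    unfolding SS_def using compact by (intro compact_Times)
  have UU: "UU \<in> sets \<mu>" and SS: "SS \<in> sets \<nu>"
    using \<open>compact UU\<close> \<open>compact SS\<close> by (auto simp: sets_\<mu> sets_\<nu> intro: borel_compact)
  have AE_\<mu>: "AE u in \<mu>. u \<in> UU"
    unfolding assms(7) by (rule AE_msupport[OF sets_\<mu>])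
  have AE_\<nu>: "AE z in \<nu>. z \<in> SS"
  proof -
    \<comment> \<open>\<open>SS\<close> is the product of the marginal supports, which may be larger
      than the support of \<open>\<nu>\<close>; its full measure therefore comes from the two
      marginals.\<close>
    have "AE \<omega> in P. X \<omega> \<in> XX"
      unfolding assms(8) by (rule AE_distrD[OF assms(2) AE_msupport]) simp
    moreover have "AE \<omega> in P. Y \<omega> \<in> YY"
      unfolding assms(9) by (rule AE_distrD[OF assms(3) AE_msupport]) simp
    ultimately have "AE \<omega> in P. (X \<omega>, Y \<omega>) \<in> SS"
      by eventually_elim (simp add: SS_def)
    then show ?thesis
      unfolding \<nu>_def using XY \<open>compact SS\<close> by (subst AE_distr_iff) (auto simp: borel_compact)
  qed

  \<comment> \<open>The spaces of the restricted measures are exactly the supports, so a bound on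
    the whole space is a bound on the sup norm.\<close>
  define M N where "M = restrict_space \<mu> UU" and "N = restrict_space \<nu> SS"
  have space_M: "space M = UU" and space_N: "space N = SS"
    by (simp_all add: M_def N_def space_restrict_space spaces)
  interpret M: prob_space M
    unfolding M_def by (rule prob_space_restrict_space_AE[OF \<mu>.prob_space_axioms UU AE_\<mu>])
  interpret N: prob_space N
    unfolding N_def by (rule prob_space_restrict_space_AE[OF \<nu>.prob_space_axioms SS AE_\<nu>])
  note integral_M = integral_restrict_space_eq_set_integral[OF UU, folded M_def]
    and integral_N = integral_restrict_space_eq_set_integral[OF SS, folded N_def]
    and set_integrable_M = integrable_restrict_space_iff_set_integrable[OF UU, folded M_def, symmetric]
    and set_integrable_N = integrable_restrict_space_iff_set_integrable[OF SS, folded N_def, symmetric]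
  have "SS \<in> sets borel"
    using SS by (simp add: sets_\<nu>)
  note integral_P = integral_restrict_space_distr[OF XY this AE_\<nu>[unfolded \<nu>_def], folded \<nu>_def, folded N_def]

  have nonempty: "UU \<noteq> {}" "XX \<noteq> {}" "YY \<noteq> {}"
    using M.not_empty N.not_empty by (auto simp: space_M space_N SS_def)
  have norm_x: "norm x \<le> M\<^sub>x" if "x \<in> XX" for x
    unfolding assms(17) using that norm_image_bdd_above compact by (intro cSUP_upper)
  have cost_cont: "continuous_on A (\<lambda>w. cost (fst w) (snd w))" for A :: "((real ^ 'dy) \<times> (real ^ 'dy)) set"
    unfolding cost_def by (intro continuous_intros) auto
  have cost_le: "cost u y \<le> c_sup" if "u \<in> UU" "y \<in> YY" for u y
  proof -
    have "compact ((\<lambda>w. cost (fst w) (snd w)) ` (UU \<times> YY))"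
      using compact by (intro compact_continuous_image cost_cont compact_Times)
    then have "bdd_above ((\<lambda>(u, y). cost u y) ` (UU \<times> YY))"
      by (auto simp: case_prod_beta' dest!: compact_imp_bounded intro: bounded_imp_bdd_above)
    then show ?thesis
      unfolding assms(18) using cSUP_upper[of "(u, y)" "UU \<times> YY" "\<lambda>(u, y). cost u y"] that by simp
  qed
  have cost_osc: "\<bar>cost u y - cost v y\<bar> \<le> L\<^sub>c * diameter UU" if "u \<in> UU" "v \<in> UU" "y \<in> YY" for u v y
  proof -
    have "norm u \<le> (SUP u\<in>UU. norm u)" "norm v \<le> (SUP u\<in>UU. norm u)" "norm y \<le> (SUP y\<in>YY. norm y)"
      using that norm_image_bdd_above compact by (auto intro!: cSUP_upper)
    then have "(norm u + norm v) / 2 + norm y \<le> L\<^sub>c"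
      unfolding assms(19) by argo
    moreover have "norm (u - v) \<le> diameter UU"
      using diameter_bounded_bound[OF compact_imp_bounded[OF \<open>compact UU\<close>] that(1,2)] by (simp add: dist_norm)
    ultimately have "norm (u - v) * ((norm u + norm v) / 2 + norm y) \<le> diameter UU * L\<^sub>c"
      by (intro mult_mono) (auto intro: order_trans[OF norm_ge_zero])
    then show ?thesis
      using cost_diff_le[of u y v] by (simp add: mult.commute)
  qed

  have fst_N: "fst \<in> borel_measurable N" and snd_N: "snd \<in> borel_measurable N" and id_M: "(\<lambda>u. u) \<in> borel_measurable M"
    unfolding M_def N_def by (intro measurable_restrict_space1;
      simp add: measurable_cong_sets[OF sets_\<mu> refl] measurable_cong_sets[OF sets_\<nu> refl] borel_prod[symmetric])+
  interpret moment_dual M N fst "\<lambda>u z. cost u (snd z)" \<epsilon> M\<^sub>x c_sup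
  proof
    show "(\<integral>z. fst z \<partial>N) = 0"
      using assms(13) by (subst integral_P) (auto simp: borel_prod[symmetric])
    show "(\<lambda>w. cost (fst w) (snd (snd w))) \<in> borel_measurable (M \<Otimes>\<^sub>M N)"
      unfolding cost_def using id_M snd_N
      by (intro borel_measurable_divide borel_measurable_power borel_measurable_norm borel_measurable_diff)
        (auto intro: measurable_compose[OF measurable_fst] measurable_compose[OF measurable_snd])
  qed (use norm_x cost_le fst_N \<open>\<epsilon> > 0\<close> in \<open>auto simp: space_M space_N SS_def cost_def\<close>)

  have dual_objective_eq: "dual_objective UU SS \<mu> \<nu> \<epsilon> f' g' h' = dual_ereal f' g' h'"
    if "set_integrable \<mu> UU f'" "set_integrable \<mu> UU g'" "set_integrable \<nu> SS h'" for f' g' h'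
    unfolding dual_objective_def dual_ereal_def gibbs_def
      nn_integral_gibbs_restrict[OF \<nu>.sigma_finite_measure_axioms sets_\<mu> sets_\<nu> UU SS that]
    by (simp add: integral_M integral_N M_def[symmetric] N_def[symmetric])
  have objective_bdd: "dual_objective UU SS \<mu> \<nu> \<epsilon> f' g' h' = ereal (dual f' g' h')"
    if "bdd_measurable M f'" "bdd_measurable M g'" "bdd_measurable N h'" for f' g' h'
    using that dual_objective_eq[of f' g' h'] dual_ereal_eq[OF that]
    by (simp add: set_integrable_M set_integrable_N M.bdd_measurable_integrable N.bdd_measurable_integrable)
  have value_le: "dual_value UU SS \<mu> \<nu> \<epsilon> \<le> ereal c_sup"
    unfolding dual_value_def
    by (intro SUP_least) (auto simp: dual_objective_eq set_integrable_M set_integrable_N dual_ereal_le)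
  \<comment> \<open>\<open>real_of_ereal\<close> is faithful on the dual value:
    \<open>value_le\<close> excludes plus infinity, and a bounded triple with real objective
    excludes minus infinity.\<close>
  have le_Dbar: "dual f' g' h' \<le> Dbar"
    if "bdd_measurable M f'" "bdd_measurable M g'" "bdd_measurable N h'" for f' g' h'
  proof -
    have "dual_objective UU SS \<mu> \<nu> \<epsilon> f' g' h' \<le> dual_value UU SS \<mu> \<nu> \<epsilon>"
      unfolding dual_value_def using that
      by (intro SUP_upper2[of "(f', g', h')"])
        (auto simp: set_integrable_M set_integrable_N M.bdd_measurable_integrable N.bdd_measurable_integrable)
    then have "ereal (dual f' g' h') \<le> dual_value UU SS \<mu> \<nu> \<epsilon>"
      by (simp only: objective_bdd[OF that])
    then show ?thesis
      using value_le unfolding assms(28) SS_def[symmetric] by (cases "dual_value UU SS \<mu> \<nu> \<epsilon>") auto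
  qed

  have bdd_fst: "bdd_measurable N fst"
    by (rule bdd_x)
  have \<Sigma>_N: "\<Sigma> = (\<chi> i j. \<integral>z. fst z $ i * fst z $ j \<partial>N)"
  proof -
    have "(\<lambda>z :: (real ^ 'dx) \<times> (real ^ 'dy). fst z $ i * fst z $ j) \<in> borel_measurable borel" for i j
      by (intro borel_measurable_continuous_onI continuous_intros)
    from integral_P[OF this] show ?thesis
      by (simp add: assms(14))
  qed
  have "0 < M\<^sub>x" using \<open>M\<^sub>x \<ge> 1\<close> by simp
  note tilt = N.second_moment_tilt[OF bdd_fst _ \<open>0 < M\<^sub>x\<close> \<Sigma>_N \<open>invertible \<Sigma>\<close> assms(29)]
  have algorithm: "modified_sinkhorn UU SS \<mu> \<nu> \<epsilon> \<eta> f g h ft gt ht"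
    using assms(26) by (simp add: SS_def)

  have "moment_sinkhorn M N fst (\<lambda>u z. cost u (snd z)) \<epsilon> M\<^sub>x c_sup \<eta> \<delta> (L\<^sub>c * diameter UU) f ft g gt h ht"
  proof
    show "1 \<le> M\<^sub>x" "0 < \<eta>" by fact+
    show "\<eta> * M\<^sub>x\<^sup>2 < 2 * \<epsilon>"
      using assms(22) \<open>0 < M\<^sub>x\<close> by (simp add: pos_less_divide_eq)
    show "0 < \<delta>"
      using tilt(1) x_bound by blast
    show "\<exists>w. (\<forall>z\<in>space N. \<bar>w \<bullet> fst z\<bar> \<le> 1 / 2) \<and> (\<integral>z. (w \<bullet> fst z) * (v \<bullet> fst z) \<partial>N) = \<delta> * norm v" for v
      using tilt(2) x_bound by blast
    show "\<bar>cost u (snd z) - cost v (snd z)\<bar> \<le> L\<^sub>c * diameter UU"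
      if "u \<in> space M" "v \<in> space M" "z \<in> space N" for u v z
      using that cost_osc by (auto simp: space_M space_N SS_def)
    show "bdd_measurable M (f 0)" "bdd_measurable M (g 0)"
      using assms(23,24) unfolding M_def C_diamond_def
      by (auto intro: bdd_measurable_continuous[OF \<open>compact UU\<close> _ sets_\<mu>])
    show "bdd_measurable N (h 0)"
      using assms(25) unfolding N_def SS_def[symmetric]
      by (rule bdd_measurable_continuous[OF \<open>compact SS\<close> _ sets_\<nu>])
    show "(\<integral>u. f 0 u \<partial>M) = 0" "(\<integral>u. g 0 u \<partial>M) = 0"
      using assms(23,24) by (simp_all add: integral_M C_diamond_def)
    fix t
    show "ht (Suc t) z = h_update (f t) (g t) z" if "z \<in> space N" for z
      using algorithm that
      by (cases z) (auto simp: modified_sinkhorn_def space_N h_update_def gibbs_def integral_M)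
    show "ft (Suc t) u = f_update (g t) (ht (Suc t)) u" if "u \<in> space M" for u
      using algorithm that by (simp add: modified_sinkhorn_def space_M f_update_def gibbs_def integral_N)
    show "gt (Suc t) u = g t u - \<eta> *\<^sub>R (\<integral>z. gibbs (ft (Suc t)) (g t) (ht (Suc t)) u z *\<^sub>R fst z \<partial>N)"
      if "u \<in> space M" for u
    proof -
      have "(\<integral>z. gibbs (ft (Suc t)) (g t) (ht (Suc t)) u z *\<^sub>R fst z \<partial>N)
        = exp (ft (Suc t) u / \<epsilon>) *\<^sub>R (LINT z:SS|\<nu>. exp ((g t u \<bullet> fst z + ht (Suc t) z - cost u (snd z)) / \<epsilon>) *\<^sub>R fst z)"
        unfolding gibbs_factor_f[of "ft (Suc t)"] scaleR_scaleR[symmetric] integral_scaleR_right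
        by (simp add: gibbs_def integral_N)
      then show ?thesis
        using algorithm that by (simp add: modified_sinkhorn_def space_M)
    qed
    show "f (Suc t) u = ft (Suc t) u - (\<integral>v. ft (Suc t) v \<partial>M)"
      "g (Suc t) u = gt (Suc t) u - (\<integral>v. gt (Suc t) v \<partial>M)" if "u \<in> space M" for u
      using algorithm that by (simp_all add: modified_sinkhorn_def space_M integral_M)
    show "h (Suc t) z = ht (Suc t) z + (\<integral>v. ft (Suc t) v \<partial>M) + (\<integral>v. gt (Suc t) v \<partial>M) \<bullet> fst z" if "z \<in> space N" for z
      using algorithm that by (cases z) (auto simp: modified_sinkhorn_def space_N integral_M)
  qed
  then interpret moment_sinkhorn M N fst "\<lambda>u z. cost u (snd z)" \<epsilon> M\<^sub>x c_sup \<eta> \<delta> "L\<^sub>c * diameter UU" f ft g gt h ht .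

  define G0 where "G0 = real_of_ereal (sup_norm UU (g 0))"
  have D: "D t \<le> Dbar" for t
    unfolding D_def by (rule le_Dbar[OF bdd_f bdd_g bdd_h])
  have G0: "\<forall>u\<in>space M. norm (g 0 u) \<le> G0"
  proof
    fix u assume u: "u \<in> space M"
    \<comment> \<open>Boundedness makes the extended sup norm finite, so
      \<open>real_of_ereal\<close> does not collapse it to zero.\<close>
    obtain B where B: "\<And>u. u \<in> UU \<Longrightarrow> norm (g 0 u) \<le> B"
      using bdd_g[of 0] unfolding bdd_measurable_def space_M by blast
    then have "sup_norm UU (g 0) \<le> ereal B"
      unfolding sup_norm_def by (intro SUP_least) simp
    moreover have "ereal (norm (g 0 u)) \<le> sup_norm UU (g 0)"
      unfolding sup_norm_def using u by (intro SUP_upper) (simp add: space_M)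
    ultimately show "norm (g 0 u) \<le> G0"
      unfolding G0_def by (cases "sup_norm UU (g 0)") auto
  qed
  have D0: "D 0 = D\<^sub>0"
    by (simp add: D_def assms(27) objective_bdd[unfolded SS_def, OF bdd_f bdd_g bdd_h])
  \<comment> \<open>The plain names \<open>Kg\<close> and \<open>Kf\<close> denote the reals fixed
    by the theorem; the \<open>local\<close> ones are the constants of the locale, taken at
    \<open>Dbar\<close> and \<open>G0\<close>.\<close>
  have Kg_eq: "local.Kg Dbar G0 = Kg"
    unfolding Kg_def[OF D G0] R_def[OF D G0] K2_def \<kappa>_def D0 unfolding G0_def assms(30,31) by (rule refl)
  have Kf_eq: "local.Kf Dbar G0 = Kf"
    by (simp add: Kf_def[OF D G0] Kg_eq D0 assms(32))
  note bounds = gt_bound[OF D G0] norm_g_le[OF D G0] ft_bound[OF D G0] f_bound[OF D G0]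
    ht_bound[OF D G0] h_bound[OF D G0]
  show ?thesis
    unfolding sup_norm_def SS_def[symmetric]
    using bounds[unfolded Kg_eq Kf_eq space_M space_N]
    by (intro allI conjI max.boundedI SUP_least) auto
qed

end
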